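(* Let $SW=\langle s,w \mid s^2=1,\ w^2=0,\ sw=-ws\rangle$ be the four-dimensional complex Sweedler algebra, and let $(R,\kappa)$ be any XC-structure on $SW$. Then the universal invariant $\mathfrak{Z}_{SW}$ associated with $(SW,R,\kappa)$ depends only on the framing: for every oriented, framed, long knot $K$ one has $$\mathfrak{Z}_{SW}(K)=\nu^{\mathrm{fr}(K)},$$ where $\nu=\sum_i \beta_i\kappa\alpha_i$ (with $R=\sum_i\alpha_i\otimes\beta_i$) and $\mathrm{fr}(K)\in\mathbb{Z}$ is the framing of $K$. In particular, $\mathfrak{Z}_{SW}(K)=1$ for every $0$-framed knot $K$.
   Context: XC-algebras. Let $A$ be a (unital associative) algebra over a commutative ring $\Bbbk$. An XC-structure on $A$ is a pair of invertible elements $R\in A\otimes A$, $\kappa\in A$ such that, writing $R=\sum_i\alpha_i\otimes\beta_i$ and $R^{-1}=\sum_i\bar\alpha_i\otimes\bar\beta_i$: (XC0) $R^{\pm1}=(\kappa\otimes\kappa)R^{\pm1}(\kappa^{-1}\otimes\kappa^{-1})$; (XC1f) $\sum_i\beta_i\kappa\alpha_i=\sum_i\alpha_i\kappa^{-1}\beta_i$; (XC2c) $1\otimes\kappa^{-1}=\sum_{i,j}\alpha_i\bar\alpha_j\otimes\bar\beta_j\kappa^{-1}\beta_i$; (XC2d) $\kappa\otimes1=\sum_{i,j}\bar\alpha_i\kappa\alpha_j\otimes\beta_j\bar\beta_i$; (XC3) $R_{12}R_{13}R_{23}=R_{23}R_{13}R_{12}$ in $A^{\otimes3}$. The triple $(A,R,\kappa)$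 is then called an XC-algebra, and one puts $\nu:=\sum_i\beta_i\kappa\alpha_i$ (this element is invertible). Rotational diagrams. A long knot is an arc properly embedded in a cube running from the bottom face to the top face, oriented upwards at both ends; knots are oriented and framed, and diagrams carry the blackboard framing, so $\mathrm{fr}(K)$ equals the writhe (number of positive minus number of negative crossings) of any diagram of $K$. A rotational diagram is a planar diagram that is assembled by joining copies of the following pieces: $I$, an arc going upwards; $X$, a positive crossing with both strands oriented upwards (the overstrand runs from bottom left to top right); $X^-$, a negative crossing with both strands oriented upwards (the overstrand runs from bottom right to top left); $C$, an embedded arc performing one full counterclockwise rotation (starts upwards, turns left over a maximum, goes down, turns right through a minimum, ends upwards); $C^-$, an embedded arc performing one full clockwise rotation (the mirror image of $C$ in a vertical line). Every long knot has a rotational diagram. Universal invariant. Given an XC-algebra $(A,R,\kappa)$ and a rotational diagram $D$ of $K$, place beads on $D$: for each $X$ a copy of $R=\sum\alpha_i\otimes\beta_i$, with $\alpha_i$ on the overstrand and $\beta_i$ on the understrand; for each $X^-$ a copy of $R^{-1}=\sum\bar\alpha_i\otimes\bar\beta_i$, with $\bar\alpha_i$ on the overstrand and $\bar\beta_i$ on the understrand; $\kappa^{-1}$ on each $C$; $\kappa$ on each $C^-$; $1$ on each $I$ (independent summation indices for different crossings). Then $\mathfrak{Z}_A(K)\in A$ is the sum over all indices of the product of the beads met while travelling along the knot following its orientation, written from right to left (the first bead met is the rightmost factor). This does not depend on the choice of $D$ and is an isotopy invariant of oriented, framed, long knots. *)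

theory Defs
  imports Complex_Main "HOL-Library.FuncSet"
begin

section \<open>Finite-dimensional complex algebras and their tensor products\<close>

text \<open>
  A class instance is a finite type of basis vectors with the structure constants of a unital
  associative complex algebra: \<open>e\<^sub>i e\<^sub>j = (\<Sum>k. struct_const i j k e\<^sub>k)\<close> and
  \<open>1 = (\<Sum>i. unit_coeff i e\<^sub>i)\<close>.  The algebra itself is the type \<open>'b alg\<close> below.
\<close>

class alg_basis = finite +
  fixes struct_const :: "'a \<Rightarrow> 'a \<Rightarrow> 'a \<Rightarrow> complex"
    and unit_coeff :: "'a \<Rightarrow> complex"
  assumes struct_assoc:
      "(\<Sum>m\<in>UNIV. struct_const i j m * struct_const m k l)
        = (\<Sum>m\<in>UNIV. struct_const j k m * struct_const i m l)"
    and unit_left: "(\<Sum>i\<in>UNIV. unit_coeff i * struct_const i j k) = (if j = k then 1 else 0)"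
    and unit_right: "(\<Sum>i\<in>UNIV. unit_coeff i * struct_const j i k) = (if j = k then 1 else 0)"

typedef 'b alg = "UNIV :: ('b \<Rightarrow> complex) set"
  morphisms coeff Alg ..

lemma coeff_Alg [simp]: "coeff (Alg f) = f"
  by (simp add: Alg_inverse)

lemma alg_eqI: "(\<And>i. coeff x i = coeff y i) \<Longrightarrow> x = y"
  by (metis coeff_inject ext)

instantiation alg :: (type) ab_group_add
begin
definition "0 = Alg (\<lambda>_. 0)"
definition "x + y = Alg (\<lambda>i. coeff x i + coeff y i)"
definition "x - y = Alg (\<lambda>i. coeff x i - coeff y i)"
definition "- x = Alg (\<lambda>i. - coeff x i)"
instance
  by standard
    (auto intro!: alg_eqI simp: zero_alg_def plus_alg_def minus_alg_def uminus_alg_def)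
end

lemma coeff_zero [simp]: "coeff 0 i = 0"
  and coeff_add [simp]: "coeff (x + y) i = coeff x i + coeff y i"
  and coeff_diff [simp]: "coeff (x - y) i = coeff x i - coeff y i"
  and coeff_uminus [simp]: "coeff (- x) i = - coeff x i"
  by (simp_all add: zero_alg_def plus_alg_def minus_alg_def uminus_alg_def)

lemma coeff_sum [simp]: "coeff (sum f A) i = (\<Sum>a\<in>A. coeff (f a) i)"
  by (induction A rule: infinite_finite_induct) auto

definition scaleC :: "complex \<Rightarrow> 'b alg \<Rightarrow> 'b alg" (infixr "*\<^sub>C" 75) where
  "c *\<^sub>C x = Alg (\<lambda>i. c * coeff x i)"

lemma coeff_scaleC [simp]: "coeff (c *\<^sub>C x) i = c * coeff x i"
  by (simp add: scaleC_def)

definition bvec :: "'b \<Rightarrow> 'b alg" where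
  "bvec i = Alg (\<lambda>j. if j = i then 1 else 0)"

lemma coeff_bvec [simp]: "coeff (bvec i) j = (if j = i then 1 else 0)"
  by (simp add: bvec_def)

lemma bvec_expansion: "x = (\<Sum>i\<in>UNIV. coeff x i *\<^sub>C bvec i)" for x :: "'b::finite alg"
  by (rule alg_eqI) (simp add: if_distrib cong: if_cong)

instantiation alg :: (alg_basis) ring_1
begin
definition "1 = Alg unit_coeff"
definition "x * y =
  Alg (\<lambda>k. \<Sum>i\<in>UNIV. \<Sum>j\<in>UNIV. coeff x i * coeff y j * struct_const i j k)"
instance
proof
  fix x y z :: "'a alg"
  have L: "coeff (x * y * z) l = (\<Sum>i\<in>UNIV. \<Sum>j\<in>UNIV. \<Sum>k\<in>UNIV.
      coeff x i * coeff y j * coeff z k * (\<Sum>m\<in>UNIV. struct_const i j m * struct_const m k l))"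
    for l
  proof -
    have "coeff (x * y * z) l = (\<Sum>m\<in>UNIV. \<Sum>k\<in>UNIV. \<Sum>i\<in>UNIV. \<Sum>j\<in>UNIV.
        coeff x i * coeff y j * coeff z k * (struct_const i j m * struct_const m k l))"
      unfolding times_alg_def coeff_Alg sum_distrib_right by (simp only: mult_ac)
    also have "\<dots> = (\<Sum>i\<in>UNIV. \<Sum>j\<in>UNIV. \<Sum>k\<in>UNIV. \<Sum>m\<in>UNIV.
        coeff x i * coeff y j * coeff z k * (struct_const i j m * struct_const m k l))"
    proof -
      have "(\<Sum>m\<in>UNIV. \<Sum>k\<in>UNIV. \<Sum>i\<in>UNIV. \<Sum>j\<in>UNIV. F i j k m)
          = (\<Sum>i\<in>UNIV. \<Sum>j\<in>UNIV. \<Sum>k\<in>UNIV. \<Sum>m\<in>UNIV. F i j k m)"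
        for F :: "'a \<Rightarrow> 'a \<Rightarrow> 'a \<Rightarrow> 'a \<Rightarrow> complex"
      proof -
        have "(\<Sum>m\<in>UNIV. \<Sum>k\<in>UNIV. \<Sum>i\<in>UNIV. \<Sum>j\<in>UNIV. F i j k m)
            = (\<Sum>(m,k,i,j)\<in>UNIV. F i j k m)"
          by (simp add: sum.cartesian_product flip: UNIV_Times_UNIV)
        also have "\<dots> = (\<Sum>(i,j,k,m)\<in>UNIV. F i j k m)"
          by (rule sum.reindex_bij_witness[where i = "\<lambda>(i,j,k,m). (m,k,i,j)"
                and j = "\<lambda>(m,k,i,j). (i,j,k,m)"]) auto
        finally show ?thesis
          by (simp add: sum.cartesian_product flip: UNIV_Times_UNIV)
      qed
      then show ?thesis .
    qed
    finally show ?thesis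
      by (simp add: sum_distrib_left)
  qed
  have R: "coeff (x * (y * z)) l = (\<Sum>i\<in>UNIV. \<Sum>j\<in>UNIV. \<Sum>k\<in>UNIV.
      coeff x i * coeff y j * coeff z k * (\<Sum>m\<in>UNIV. struct_const j k m * struct_const i m l))"
    for l
  proof -
    have "coeff (x * (y * z)) l = (\<Sum>i\<in>UNIV. \<Sum>m\<in>UNIV. \<Sum>j\<in>UNIV. \<Sum>k\<in>UNIV.
        coeff x i * coeff y j * coeff z k * (struct_const j k m * struct_const i m l))"
      by (simp add: times_alg_def sum_distrib_right sum_distrib_left mult_ac)
    also have "\<dots> = (\<Sum>i\<in>UNIV. \<Sum>j\<in>UNIV. \<Sum>k\<in>UNIV. \<Sum>m\<in>UNIV.
        coeff x i * coeff y j * coeff z k * (struct_const j k m * struct_const i m l))"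
    proof (rule sum.cong[OF refl])
      fix i
      have "(\<Sum>m\<in>UNIV. \<Sum>j\<in>UNIV. \<Sum>k\<in>UNIV. F j k m)
          = (\<Sum>j\<in>UNIV. \<Sum>k\<in>UNIV. \<Sum>m\<in>UNIV. F j k m)"
        for F :: "'a \<Rightarrow> 'a \<Rightarrow> 'a \<Rightarrow> complex"
        by (subst sum.swap, rule sum.cong[OF refl], rule sum.swap)
      then show "(\<Sum>m\<in>UNIV. \<Sum>j\<in>UNIV. \<Sum>k\<in>UNIV.
          coeff x i * coeff y j * coeff z k * (struct_const j k m * struct_const i m l))
        = (\<Sum>j\<in>UNIV. \<Sum>k\<in>UNIV. \<Sum>m\<in>UNIV.
          coeff x i * coeff y j * coeff z k * (struct_const j k m * struct_const i m l))" .
    qed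
    finally show ?thesis
      by (simp add: sum_distrib_left)
  qed
  show "x * y * z = x * (y * z)"
    by (rule alg_eqI) (simp only: L R struct_assoc)
  show "1 * x = x"
  proof (rule alg_eqI)
    fix k
    have "coeff (1 * x) k
        = (\<Sum>i\<in>UNIV. \<Sum>j\<in>UNIV. coeff x j * (unit_coeff i * struct_const i j k))"
      by (simp add: one_alg_def times_alg_def mult_ac)
    also have "\<dots> = (\<Sum>j\<in>UNIV. coeff x j * (\<Sum>i\<in>UNIV. unit_coeff i * struct_const i j k))"
      by (subst sum.swap) (simp add: sum_distrib_left)
    finally show "coeff (1 * x) k = coeff x k"
      by (simp add: unit_left if_distrib cong: if_cong)
  qed
  show "x * 1 = x"
  proof (rule alg_eqI)
    fix k
    have "coeff (x * 1) k
        = (\<Sum>j\<in>UNIV. coeff x j * (\<Sum>i\<in>UNIV. unit_coeff i * struct_const j i k))"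
      by (simp add: one_alg_def times_alg_def sum_distrib_left mult_ac)
    then show "coeff (x * 1) k = coeff x k"
      by (simp add: unit_right if_distrib cong: if_cong)
  qed
  show "(x + y) * z = x * z + y * z" "x * (y + z) = x * y + x * z"
    by (auto intro!: alg_eqI simp: times_alg_def algebra_simps sum.distrib)
  show "(0 :: 'a alg) \<noteq> 1"
  proof
    assume "(0 :: 'a alg) = 1"
    then have "unit_coeff (i :: 'a) = 0" for i
      by (metis coeff_Alg coeff_zero one_alg_def)
    then show False
      using unit_left[of "undefined :: 'a" "undefined :: 'a"] by simp
  qed
qed
end

lemma coeff_one: "coeff 1 i = unit_coeff i"
  by (simp add: one_alg_def)

lemma coeff_mult:
  "coeff (x * y) k = (\<Sum>i\<in>UNIV. \<Sum>j\<in>UNIV. coeff x i * coeff y j * struct_const i j k)"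
  by (simp add: times_alg_def)

lemma scaleC_mult_left: "(c *\<^sub>C x) * y = c *\<^sub>C (x * y)"
  and scaleC_mult_right: "x * (c *\<^sub>C y) = c *\<^sub>C (x * y)"
  by (auto intro!: alg_eqI simp: coeff_mult sum_distrib_left mult_ac)

definition invertible :: "'b::alg_basis alg \<Rightarrow> bool" where
  "invertible x \<longleftrightarrow> (\<exists>y. x * y = 1 \<and> y * x = 1)"

text \<open>The inverse of a non-invertible element is set to \<open>0\<close>; with this, the library's
  integer powers \<open>x powi n\<close> are the usual ones for invertible \<open>x\<close>.\<close>

instantiation alg :: (alg_basis) inverse
begin
definition "inverse x = (if invertible x then THE y. x * y = 1 \<and> y * x = 1 else 0)"
definition "x div y = x * inverse y" for x y :: "'a alg"
instance ..
end

lemma inverse_alg_eqI: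
  fixes x :: "'b::alg_basis alg"
  assumes "x * y = 1" "y * x = 1"
  shows "inverse x = y"
proof -
  have "z = y" if "x * z = 1 \<and> z * x = 1" for z
  proof -
    have "z = y * x * z"
      using assms(2) by simp
    also have "\<dots> = y"
      using that by (simp add: mult.assoc)
    finally show ?thesis .
  qed
  then have "(THE z. x * z = 1 \<and> z * x = 1) = y"
    using assms by (intro the_equality) blast+
  moreover have "invertible x"
    using assms unfolding invertible_def by blast
  ultimately show ?thesis
    by (simp only: inverse_alg_def if_True)
qed

lemma invertible_inverse:
  fixes x :: "'b::alg_basis alg"
  assumes "invertible x"
  shows "x * inverse x = 1" "inverse x * x = 1"
proof -
  obtain y where "x * y = 1" "y * x = 1"
    using assms unfolding invertible_def by blast
  then show "x * inverse x = 1" "inverse x * x = 1"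
    using inverse_alg_eqI[of x y] by simp_all
qed

text \<open>If \<open>A\<close> and \<open>B\<close> have bases \<open>(e\<^sub>i)\<close> and \<open>(f\<^sub>j)\<close> then \<open>A \<otimes> B\<close> is the algebra with basis
  \<open>(e\<^sub>i \<otimes> f\<^sub>j)\<close> and the componentwise product.\<close>

instantiation prod :: (alg_basis, alg_basis) alg_basis
begin
definition "struct_const x y z =
  struct_const (fst x) (fst y) (fst z) * struct_const (snd x) (snd y) (snd z)"
definition "unit_coeff x = unit_coeff (fst x) * unit_coeff (snd x)"
instance
proof
  have P: "(\<Sum>m\<in>UNIV. F (fst m) * G (snd m)) = (\<Sum>a\<in>UNIV. F a) * (\<Sum>b\<in>UNIV. G b)"
    for F :: "'a \<Rightarrow> complex" and G :: "'b \<Rightarrow> complex"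
    by (simp add: sum_product sum.cartesian_product case_prod_beta flip: UNIV_Times_UNIV)
  fix i j k l :: "'a \<times> 'b"
  show "(\<Sum>m\<in>UNIV. struct_const i j m * struct_const m k l)
      = (\<Sum>m\<in>UNIV. struct_const j k m * struct_const i m l)"
  proof -
    have "(\<Sum>m\<in>UNIV. struct_const i j m * struct_const m k l)
        = (\<Sum>m\<in>UNIV. struct_const (fst i) (fst j) m * struct_const m (fst k) (fst l))
          * (\<Sum>m\<in>UNIV. struct_const (snd i) (snd j) m * struct_const m (snd k) (snd l))"
      by (subst P[symmetric], rule sum.cong) (simp_all add: struct_const_prod_def)
    also have "\<dots>
        = (\<Sum>m\<in>UNIV. struct_const (fst j) (fst k) m * struct_const (fst i) m (fst l))
          * (\<Sum>m\<in>UNIV. struct_const (snd j) (snd k) m * struct_const (snd i) m (snd l))"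
      by (simp only: struct_assoc)
    also have "\<dots> = (\<Sum>m\<in>UNIV. struct_const j k m * struct_const i m l)"
      by (subst P[symmetric], rule sum.cong) (simp_all add: struct_const_prod_def)
    finally show ?thesis .
  qed
  show "(\<Sum>i\<in>UNIV. unit_coeff i * struct_const i j k) = (if j = k then 1 else 0)"
    using P[of "\<lambda>m. unit_coeff m * struct_const m (fst j) (fst k)"
        "\<lambda>m. unit_coeff m * struct_const m (snd j) (snd k)"]
    by (auto simp: struct_const_prod_def unit_coeff_prod_def unit_left mult_ac prod_eq_iff)
  show "(\<Sum>i\<in>UNIV. unit_coeff i * struct_const j i k) = (if j = k then 1 else 0)"
    using P[of "\<lambda>m. unit_coeff m * struct_const (fst j) m (fst k)"
        "\<lambda>m. unit_coeff m * struct_const (snd j) m (snd k)"]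
    by (auto simp: struct_const_prod_def unit_coeff_prod_def unit_right mult_ac prod_eq_iff)
qed
end

definition tensor :: "'b alg \<Rightarrow> 'c alg \<Rightarrow> ('b \<times> 'c) alg" (infixr "\<otimes>" 75) where
  "x \<otimes> y = Alg (\<lambda>(i, j). coeff x i * coeff y j)"

lemma coeff_tensor [simp]: "coeff (x \<otimes> y) ij = coeff x (fst ij) * coeff y (snd ij)"
  by (simp add: tensor_def case_prod_beta)

lemma tensor_one: "(1 :: ('b::alg_basis \<times> 'c::alg_basis) alg) = 1 \<otimes> 1"
  by (rule alg_eqI) (simp add: coeff_one unit_coeff_prod_def)

lemma tensor_mult: "(x \<otimes> y) * (x' \<otimes> y') = (x * x') \<otimes> (y * y')"
proof (rule alg_eqI)
  fix k
  have P: "(\<Sum>m\<in>UNIV. F m) = (\<Sum>a\<in>UNIV. \<Sum>b\<in>UNIV. F (a, b))"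
    for F :: "'a \<times> 'b \<Rightarrow> complex"
    by (simp add: sum.cartesian_product case_prod_beta flip: UNIV_Times_UNIV)
  have Q: "(\<Sum>a\<in>UNIV. \<Sum>b\<in>UNIV. \<Sum>c\<in>UNIV. \<Sum>d\<in>UNIV. F a c * G b d)
      = (\<Sum>a\<in>UNIV. \<Sum>c\<in>UNIV. F a c) * (\<Sum>b\<in>UNIV. \<Sum>d\<in>UNIV. G b d)"
    for F :: "'a \<Rightarrow> 'a \<Rightarrow> complex" and G :: "'b \<Rightarrow> 'b \<Rightarrow> complex"
    by (simp add: sum_product)
  have "coeff ((x \<otimes> y) * (x' \<otimes> y')) k
      = (\<Sum>a\<in>UNIV. \<Sum>b\<in>UNIV. \<Sum>c\<in>UNIV. \<Sum>d\<in>UNIV.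
          (coeff x a * coeff x' c * struct_const a c (fst k))
          * (coeff y b * coeff y' d * struct_const b d (snd k)))"
    unfolding coeff_mult P by (simp add: struct_const_prod_def mult_ac)
  also have "\<dots> = coeff ((x * x') \<otimes> (y * y')) k"
    unfolding Q by (simp add: coeff_mult)
  finally show "coeff ((x \<otimes> y) * (x' \<otimes> y')) k = coeff ((x * x') \<otimes> (y * y')) k" .
qed

text \<open>For \<open>T = (\<Sum>i. a\<^sub>i \<otimes> b\<^sub>i)\<close> and bilinear \<open>f\<close>, \<open>tsum T f = (\<Sum>i. f a\<^sub>i b\<^sub>i)\<close>.  The definition
  uses the expansion of \<open>T\<close> in the basis, and the lemma \<open>tsum_eq\<close> shows that any other
  expansion gives the same value.\<close>

definition tsum :: "('b \<times> 'c) alg \<Rightarrow> ('b alg \<Rightarrow> 'c alg \<Rightarrow> 'd alg) \<Rightarrow> 'd alg" where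
  "tsum T f = (\<Sum>(i, j)\<in>UNIV. coeff T (i, j) *\<^sub>C f (bvec i) (bvec j))"

lemma tsum_eq:
  fixes f :: "'b::finite alg \<Rightarrow> 'c::finite alg \<Rightarrow> 'd alg"
  assumes add: "\<And>x x' y. f (x + x') y = f x y + f x' y" "\<And>x y y'. f x (y + y') = f x y + f x y'"
    and scale: "\<And>c x y. f (c *\<^sub>C x) y = c *\<^sub>C f x y" "\<And>c x y. f x (c *\<^sub>C y) = c *\<^sub>C f x y"
    and T: "T = (\<Sum>k\<in>K. a k \<otimes> b k)"
  shows "tsum T f = (\<Sum>k\<in>K. f (a k) (b k))"
proof -
  have z: "f 0 y = 0" "f x 0 = 0" for x y
    using add(1)[of 0 0 y] add(2)[of x 0 0] by simp_all
  have s1: "f (\<Sum>i\<in>I. g i) y = (\<Sum>i\<in>I. f (g i) y)" for I :: "'b set" and g y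
    by (induction I rule: infinite_finite_induct) (auto simp: z add)
  have s2: "f x (\<Sum>i\<in>I. g i) = (\<Sum>i\<in>I. f x (g i))" for I :: "'c set" and g x
    by (induction I rule: infinite_finite_induct) (auto simp: z add)
  have *: "f x y = (\<Sum>(i, j)\<in>UNIV. (coeff x i * coeff y j) *\<^sub>C f (bvec i) (bvec j))" for x y
  proof -
    have "f x y = f (\<Sum>i\<in>UNIV. coeff x i *\<^sub>C bvec i) (\<Sum>j\<in>UNIV. coeff y j *\<^sub>C bvec j)"
      by (simp flip: bvec_expansion)
    also have "\<dots> = (\<Sum>i\<in>UNIV. \<Sum>j\<in>UNIV. (coeff x i * coeff y j) *\<^sub>C f (bvec i) (bvec j))"
      by (subst s1, subst s2) (intro alg_eqI, simp add: scale sum_distrib_left mult_ac)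
    also have "\<dots> = (\<Sum>(i, j)\<in>UNIV. (coeff x i * coeff y j) *\<^sub>C f (bvec i) (bvec j))"
      by (simp add: sum.cartesian_product flip: UNIV_Times_UNIV)
    finally show ?thesis .
  qed
  have "(\<Sum>k\<in>K. f (a k) (b k))
      = (\<Sum>k\<in>K. \<Sum>(i, j)\<in>UNIV. (coeff (a k) i * coeff (b k) j) *\<^sub>C f (bvec i) (bvec j))"
    by (rule sum.cong[OF refl *])
  also have "\<dots>
      = (\<Sum>(i, j)\<in>UNIV. \<Sum>k\<in>K. (coeff (a k) i * coeff (b k) j) *\<^sub>C f (bvec i) (bvec j))"
    by (subst sum.swap) (simp add: case_prod_beta)
  also have "\<dots> = tsum T f"
    unfolding tsum_def T
    by (intro sum.cong refl) (auto intro!: alg_eqI simp: sum_distrib_right)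
  finally show ?thesis ..
qed


section \<open>XC-structures\<close>

definition R12 :: "('b::alg_basis \<times> 'b) alg \<Rightarrow> ('b \<times> 'b \<times> 'b) alg" where
  "R12 R = tsum R (\<lambda>\<alpha> \<beta>. \<alpha> \<otimes> \<beta> \<otimes> 1)"

definition R13 :: "('b::alg_basis \<times> 'b) alg \<Rightarrow> ('b \<times> 'b \<times> 'b) alg" where
  "R13 R = tsum R (\<lambda>\<alpha> \<beta>. \<alpha> \<otimes> 1 \<otimes> \<beta>)"

definition R23 :: "('b::alg_basis \<times> 'b) alg \<Rightarrow> ('b \<times> 'b \<times> 'b) alg" where
  "R23 R = tsum R (\<lambda>\<alpha> \<beta>. 1 \<otimes> \<alpha> \<otimes> \<beta>)"

definition XC_structure :: "('b::alg_basis \<times> 'b) alg \<Rightarrow> 'b alg \<Rightarrow> bool" where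
  "XC_structure R \<kappa> \<longleftrightarrow>
     invertible R \<and> invertible \<kappa> \<and>
     \<comment> \<open>XC0\<close>
     R = (\<kappa> \<otimes> \<kappa>) * R * (inverse \<kappa> \<otimes> inverse \<kappa>) \<and>
     inverse R = (\<kappa> \<otimes> \<kappa>) * inverse R * (inverse \<kappa> \<otimes> inverse \<kappa>) \<and>
     \<comment> \<open>XC1f\<close>
     tsum R (\<lambda>\<alpha> \<beta>. \<beta> * \<kappa> * \<alpha>) = tsum R (\<lambda>\<alpha> \<beta>. \<alpha> * inverse \<kappa> * \<beta>) \<and>
     \<comment> \<open>XC2c\<close>
     1 \<otimes> inverse \<kappa> =
       tsum R (\<lambda>\<alpha> \<beta>. tsum (inverse R) (\<lambda>\<alpha>' \<beta>'. (\<alpha> * \<alpha>') \<otimes> (\<beta>' * inverse \<kappa> * \<beta>))) \<and>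
     \<comment> \<open>XC2d\<close>
     \<kappa> \<otimes> 1 =
       tsum (inverse R) (\<lambda>\<alpha>' \<beta>'. tsum R (\<lambda>\<alpha> \<beta>. (\<alpha>' * \<kappa> * \<alpha>) \<otimes> (\<beta> * \<beta>'))) \<and>
     \<comment> \<open>XC3\<close>
     R12 R * R13 R * R23 R = R23 R * R13 R * R12 R"

definition nu :: "('b::alg_basis \<times> 'b) alg \<Rightarrow> 'b alg \<Rightarrow> 'b alg" where
  "nu R \<kappa> = tsum R (\<lambda>\<alpha> \<beta>. \<beta> * \<kappa> * \<alpha>)"


section \<open>Rotational diagrams of long knots\<close>

text \<open>
  A rotational diagram is put in Morse position and recorded as the list of its elementary
  slices, from bottom to top.  A horizontal line between two slices meets the diagram in strands
  numbered \<open>0, 1, \<dots>\<close> from left to right.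

    \<^item> \<open>Cross p \<epsilon>\<close> crosses the strands \<open>p\<close> and \<open>p + 1\<close>, both oriented upwards;
    \<^item> \<open>Max p t\<close> joins the strands \<open>p\<close> and \<open>p + 1\<close> by a local maximum;
    \<^item> \<open>Min p t\<close> creates new adjacent strands \<open>p\<close> and \<open>p + 1\<close> by a local minimum.

  A maximum or minimum is \<open>CCW\<close> if it is traversed counterclockwise.  That is a maximum going
  from right to left or a minimum going from left to right, so in both cases the left strand is
  the downward one.
\<close>

datatype dir = Up | Down
datatype sign = Pos | Neg
datatype turn = CCW | CW

datatype slice = Cross nat sign | Max nat turn | Min nat turn

type_synonym diagram = "slice list"

fun turn_dirs :: "turn \<Rightarrow> dir list" where
  "turn_dirs CCW = [Down, Up]"
| "turn_dirs CW = [Up, Down]"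

text \<open>\<open>fits s ds\<close>: the slice \<open>s\<close> can be put on top of strands with the directions \<open>ds\<close>;
  \<open>above s ds\<close> are then the directions on top of it.\<close>

fun fits :: "slice \<Rightarrow> dir list \<Rightarrow> bool" where
  "fits (Cross p \<epsilon>) ds \<longleftrightarrow> p + 1 < length ds \<and> ds ! p = Up \<and> ds ! (p + 1) = Up"
| "fits (Max p t) ds \<longleftrightarrow> p + 1 < length ds \<and> [ds ! p, ds ! (p + 1)] = turn_dirs t"
| "fits (Min p t) ds \<longleftrightarrow> p \<le> length ds"

fun above :: "slice \<Rightarrow> dir list \<Rightarrow> dir list" where
  "above (Cross p \<epsilon>) ds = ds"
| "above (Max p t) ds = take p ds @ drop (p + 2) ds"
| "above (Min p t) ds = take p ds @ turn_dirs t @ drop p ds"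

definition level :: "diagram \<Rightarrow> nat \<Rightarrow> dir list" where
  "level D k = fold above (take k D) [Up]"

definition well_formed :: "diagram \<Rightarrow> bool" where
  "well_formed D \<longleftrightarrow> (\<forall>k < length D. fits (D ! k) (level D k)) \<and> level D (length D) = [Up]"

text \<open>Travelling: a point \<open>(k, p)\<close> is the intersection of strand \<open>p\<close> with the horizontal line
  below slice \<open>k\<close> (above the last slice, if \<open>k = length D\<close>).  \<open>next_pt\<close> moves along the
  orientation through one slice, and stays put at the upper end of the knot.\<close>

type_synonym point = "nat \<times> nat"

definition points :: "diagram \<Rightarrow> point set" where
  "points D = {(k, p). k \<le> length D \<and> p < length (level D k)}"

definition next_pt :: "diagram \<Rightarrow> point \<Rightarrow> point" where
  "next_pt D = (\<lambda>(k, p).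
     if level D k ! p = Up then
       if k = length D then (k, p)
       else case D ! k of
         Cross q \<epsilon> \<Rightarrow> (k + 1, if p = q then q + 1 else if p = q + 1 then q else p)
       | Max q t \<Rightarrow> if p = q then (k, q + 1) else if p = q + 1 then (k, q)
                   else (k + 1, if p < q then p else p - 2)
       | Min q t \<Rightarrow> (k + 1, if p < q then p else p + 2)
     else
       case D ! (k - 1) of
         Cross q \<epsilon> \<Rightarrow> (k - 1, p)
       | Max q t \<Rightarrow> (k - 1, if p < q then p else p + 2)
       | Min q t \<Rightarrow> if p = q then (k, q + 1) else if p = q + 1 then (k, q)
                   else (k - 1, if p < q then p else p - 2))"

definition traversal :: "diagram \<Rightarrow> point list" where
  "traversal D = map (\<lambda>n. (next_pt D ^^ n) (0, 0)) [0..<card (points D)]"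

text \<open>There are no closed components.\<close>

definition single_arc :: "diagram \<Rightarrow> bool" where
  "single_arc D \<longleftrightarrow> set (traversal D) = points D"

text \<open>What is met between a point and the next one; \<open>Over k\<close> and \<open>Under k\<close> are the passages
  through the crossing in slice \<open>k\<close>.  The overstrand runs from bottom left to top right at a
  positive crossing and from bottom right to top left at a negative one.\<close>

datatype event = Over nat | Under nat | MaxTurn turn | MinTurn turn

definition events_at :: "diagram \<Rightarrow> point \<Rightarrow> event list" where
  "events_at D = (\<lambda>(k, p).
     if level D k ! p = Up then
       if k = length D then []
       else case D ! k of
         Cross q \<epsilon> \<Rightarrow> if p = q then [if \<epsilon> = Pos then Over k else Under k]
                     else if p = q + 1 then [if \<epsilon> = Pos then Under k else Over k]
                     else []
       | Max q t \<Rightarrow> if p = q \<or> p = q + 1 then [MaxTurn t] else []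
       | Min q t \<Rightarrow> []
     else
       case D ! (k - 1) of
         Cross q \<epsilon> \<Rightarrow> []
       | Max q t \<Rightarrow> []
       | Min q t \<Rightarrow> if p = q \<or> p = q + 1 then [MinTurn t] else [])"

definition events :: "diagram \<Rightarrow> event list" where
  "events D = concat (map (events_at D) (traversal D))"

text \<open>In a rotational diagram the maxima and minima come in pairs forming the full rotations
  \<open>C\<close> (a \<open>CCW\<close> maximum followed by a \<open>CCW\<close> minimum) and \<open>C\<^sup>-\<close> (both \<open>CW\<close>).\<close>

fun full_rotations :: "event list \<Rightarrow> bool" where
  "full_rotations [] \<longleftrightarrow> True"
| "full_rotations (Over k # es) \<longleftrightarrow> full_rotations es"
| "full_rotations (Under k # es) \<longleftrightarrow> full_rotations es"
| "full_rotations (MaxTurn t # MinTurn t' # es) \<longleftrightarrow> t = t' \<and> full_rotations es"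
| "full_rotations _ \<longleftrightarrow> False"

definition rotational_diagram :: "diagram \<Rightarrow> bool" where
  "rotational_diagram D \<longleftrightarrow> well_formed D \<and> single_arc D \<and> full_rotations (events D)"

definition crossings :: "diagram \<Rightarrow> sign \<Rightarrow> nat set" where
  "crossings D \<epsilon> = {k. k < length D \<and> (\<exists>p. D ! k = Cross p \<epsilon>)}"

text \<open>The framing of the knot, as diagrams carry the blackboard framing.\<close>

definition writhe :: "diagram \<Rightarrow> int" where
  "writhe D = int (card (crossings D Pos)) - int (card (crossings D Neg))"


section \<open>The universal invariant\<close>

text \<open>
  With \<open>R\<^sup>\<plusminus>\<^sup>1\<close> expanded in the basis \<open>e\<^sub>i \<otimes> e\<^sub>j\<close>, the sum runs over all ways \<open>c\<close> of choosing a pair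
  of indices \<open>(i, j)\<close> at each crossing; the coefficients are collected in front of the product
  and the crossing contributes the beads \<open>e\<^sub>i\<close> and \<open>e\<^sub>j\<close>.  The bead of a full rotation \<open>C\<close> or
  \<open>C\<^sup>-\<close> is placed at its maximum.
\<close>

fun bead :: "'b::alg_basis alg \<Rightarrow> (nat \<Rightarrow> 'b \<times> 'b) \<Rightarrow> event \<Rightarrow> 'b alg" where
  "bead \<kappa> c (Over k) = bvec (fst (c k))"
| "bead \<kappa> c (Under k) = bvec (snd (c k))"
| "bead \<kappa> c (MaxTurn CCW) = inverse \<kappa>"
| "bead \<kappa> c (MaxTurn CW) = \<kappa>"
| "bead \<kappa> c (MinTurn t) = 1"

definition universal_inv ::
    "('b::alg_basis \<times> 'b) alg \<Rightarrow> 'b alg \<Rightarrow> diagram \<Rightarrow> 'b alg" where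
  "universal_inv R \<kappa> D =
     (\<Sum>c \<in> (crossings D Pos \<union> crossings D Neg) \<rightarrow>\<^sub>E UNIV.
        ((\<Prod>k\<in>crossings D Pos. coeff R (c k)) * (\<Prod>k\<in>crossings D Neg. coeff (inverse R) (c k)))
          *\<^sub>C prod_list (map (bead \<kappa> c) (rev (events D))))"


section \<open>The Sweedler algebra\<close>

text \<open>\<open>Mono i j\<close> stands for the basis monomial \<open>s\<^sup>i w\<^sup>j\<close>, with exponents \<open>0\<close> (\<open>False\<close>) or \<open>1\<close>
  (\<open>True\<close>), and \<open>s\<^sup>i w\<^sup>j s\<^sup>k w\<^sup>l = (-1)\<^bsup>jk\<^esup> s\<^bsup>i+k\<^esup> w\<^bsup>j+l\<^esup>\<close>.\<close>

datatype sw = Mono (s_exp: bool) (w_exp: bool)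

instantiation sw :: alg_basis
begin
definition "struct_const x y z =
  (if w_exp x \<and> w_exp y \<or> z \<noteq> Mono (s_exp x \<noteq> s_exp y) (w_exp x \<or> w_exp y) then 0
   else if w_exp x \<and> s_exp y then - 1 else 1)"
definition "unit_coeff x = (if x = Mono False False then 1 else 0)"
instance
proof -
  have U: "(UNIV :: sw set) =
      {Mono False False, Mono True False, Mono False True, Mono True True}"
    by (auto, metis (full_types) sw.exhaust)
  have fin: "finite (UNIV :: sw set)"
    by (simp add: U)
  show "OFCLASS(sw, alg_basis_class)"
  proof
    fix i j k l :: sw
    show "finite (UNIV :: sw set)" by (fact fin)
    show "(\<Sum>m\<in>UNIV. struct_const i j m * struct_const m k l)
        = (\<Sum>m\<in>UNIV. struct_const j k m * struct_const i m l)"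
      by (cases i; cases j; cases k; cases l) (auto simp: U struct_const_sw_def)
    show "(\<Sum>i\<in>UNIV. unit_coeff i * struct_const i j k) = (if j = k then 1 else 0)"
      "(\<Sum>i\<in>UNIV. unit_coeff i * struct_const j i k) = (if j = k then 1 else 0)"
      by (cases j; cases k; auto simp: U struct_const_sw_def unit_coeff_sw_def)+
  qed
qed
end

type_synonym SW = "sw alg"

definition sw_s :: SW where "sw_s = bvec (Mono True False)"
definition sw_w :: SW where "sw_w = bvec (Mono False True)"

lemma UNIV_sw:
  "(UNIV :: sw set) = {Mono False False, Mono True False, Mono False True, Mono True True}"
  by (auto, metis (full_types) sw.exhaust)

lemma SW_relations: "sw_s * sw_s = 1" "sw_w * sw_w = 0" "sw_s * sw_w = - (sw_w * sw_s)"
  by (auto intro!: alg_eqI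
      simp: sw_s_def sw_w_def coeff_mult coeff_one UNIV_sw struct_const_sw_def unit_coeff_sw_def)

lemma SW_basis:
  "bvec (Mono False False) = (1 :: SW)" "bvec (Mono True False) = sw_s"
  "bvec (Mono False True) = sw_w" "bvec (Mono True True) = sw_s * sw_w"
  by (auto intro!: alg_eqI
      simp: sw_s_def sw_w_def coeff_mult coeff_one UNIV_sw struct_const_sw_def unit_coeff_sw_def)

end

theory Submission
  imports Defs
begin

text \<open>
  The Sweedler algebra is separated by two characters \<open>\<chi>\<close> and two skew derivations \<open>d\<close> with
  \<open>d (x y) = d x \<cdot> \<chi> y + \<chi>' x \<cdot> d y\<close>, so it suffices to evaluate these on the invariant.  A character
  turns the state sum into a product over the crossings and maxima; here \<open>\<chi> \<kappa> = \<plusminus>1\<close> by (XC1f), and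
  the parities of the rotation number and of the writhe agree by Whitney's formula.  A skew
  derivation turns it into a sum over the bead to which \<open>d\<close> is applied.  The degree one part of the
  Yang-Baxter equation and (XC0) leave two cases.  Either \<open>d\<close> agrees on all beads with the inner
  skew derivation \<open>t (\<chi> - \<chi>')\<close>, and then also on the invariant.  Or \<open>\<chi>\<close> and \<open>\<chi>'\<close> agree on
  all beads, and every crossing contributes a constant that depends on its sign and on which strand
  is travelled first; by (XC1f) the dependence on the latter is compensated by the beads \<open>\<kappa>\<^sup>\<plusminus>\<^sup>1\<close>, as
  Whitney's formula expresses the rotation number by these data.
\<close>

section \<open>Linear functionals, characters and skew derivations\<close>

definition clinear :: "('b alg \<Rightarrow> complex) \<Rightarrow> bool" where
  "clinear f \<longleftrightarrow> (\<forall>x y. f (x + y) = f x + f y) \<and> (\<forall>c x. f (c *\<^sub>C x) = c * f x)"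

definition character :: "('b::alg_basis alg \<Rightarrow> complex) \<Rightarrow> bool" where
  "character \<chi> \<longleftrightarrow> clinear \<chi> \<and> \<chi> 1 = 1 \<and> (\<forall>x y. \<chi> (x * y) = \<chi> x * \<chi> y)"

text \<open>For characters \<open>\<chi>\<close> and \<open>\<chi>'\<close> this says that
  \<open>d\<close> is the off-diagonal entry of an upper triangular 2 x 2 matrix representation with
  diagonal \<open>\<chi>'\<close>, \<open>\<chi>\<close>.\<close>

definition skew_derivation ::
    "('b::alg_basis alg \<Rightarrow> complex) \<Rightarrow> ('b alg \<Rightarrow> complex) \<Rightarrow> ('b alg \<Rightarrow> complex) \<Rightarrow> bool" where
  "skew_derivation \<chi> \<chi>' d \<longleftrightarrow> clinear d \<and> (\<forall>x y. d (x * y) = d x * \<chi> y + \<chi>' x * d y)"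

lemma clinear_add: "clinear f \<Longrightarrow> f (x + y) = f x + f y"
  and clinear_scaleC: "clinear f \<Longrightarrow> f (c *\<^sub>C x) = c * f x"
  by (auto simp: clinear_def)

lemma clinear_zero: "clinear f \<Longrightarrow> f 0 = 0"
  using clinear_add[of f 0 0] by simp

lemma clinear_sum: "clinear f \<Longrightarrow> f (sum g A) = (\<Sum>a\<in>A. f (g a))"
  by (induction A rule: infinite_finite_induct) (auto simp: clinear_zero clinear_add)

lemma clinear_expansion: "clinear f \<Longrightarrow> f x = (\<Sum>i\<in>UNIV. coeff x i * f (bvec i))"
  for x :: "'b::finite alg"
  by (subst bvec_expansion) (simp add: clinear_sum clinear_scaleC)

lemma clinear_tsum:
  fixes T :: "('b::finite \<times> 'c::finite) alg"
  assumes "clinear F"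
  shows "F (tsum T f) = (\<Sum>i\<in>UNIV. \<Sum>j\<in>UNIV. coeff T (i, j) * F (f (bvec i) (bvec j)))"
  unfolding tsum_def clinear_sum[OF assms]
  by (simp add: sum.cartesian_product case_prod_beta clinear_scaleC[OF assms] flip: UNIV_Times_UNIV)

lemma character_clinear: "character \<chi> \<Longrightarrow> clinear \<chi>"
  and character_one: "character \<chi> \<Longrightarrow> \<chi> 1 = 1"
  and character_mult: "character \<chi> \<Longrightarrow> \<chi> (x * y) = \<chi> x * \<chi> y"
  by (auto simp: character_def)

lemma skew_derivation_clinear: "skew_derivation \<chi> \<chi>' d \<Longrightarrow> clinear d"
  and skew_derivation_mult: "skew_derivation \<chi> \<chi>' d \<Longrightarrow> d (x * y) = d x * \<chi> y + \<chi>' x * d y"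
  by (auto simp: skew_derivation_def)

lemma skew_derivation_one:
  assumes "skew_derivation \<chi> \<chi>' d" "character \<chi>" "character \<chi>'"
  shows "d 1 = 0"
  using skew_derivation_mult[OF assms(1), of 1 1] assms(2,3) by (simp add: character_one)

lemma character_inverse:
  assumes "character \<chi>" "invertible x"
  shows "\<chi> x \<noteq> 0" "\<chi> (inverse x) = inverse (\<chi> x)"
proof -
  have "\<chi> x * \<chi> (inverse x) = 1"
    using assms by (metis character_mult character_one invertible_inverse(1))
  then show "\<chi> x \<noteq> 0" "\<chi> (inverse x) = inverse (\<chi> x)"
    by (auto simp: inverse_unique)
qed

text \<open>Apply \<open>d\<close> to \<open>x * inverse x = 1\<close>.\<close>

lemma skew_derivation_inverse:
  assumes "skew_derivation \<chi> \<chi>' d" "character \<chi>" "character \<chi>'" "invertible x"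
  shows "d (inverse x) = - d x / (\<chi> x * \<chi>' x)"
proof -
  have "d x * \<chi> (inverse x) + \<chi>' x * d (inverse x) = 0"
    using skew_derivation_mult[OF assms(1), of x "inverse x"] skew_derivation_one[OF assms(1-3)]
      invertible_inverse(1)[OF assms(4)] by simp
  then show ?thesis
    using character_inverse[OF assms(2,4)] character_inverse[OF assms(3,4)]
    by (simp add: field_simps add_eq_0_iff)
qed

text \<open>The difference \<open>\<chi> - \<chi>'\<close> satisfies the twisted Leibniz rule
  itself: the mixed terms \<open>\<chi>' x * \<chi> y\<close> cancel. It is the inner skew
  derivation.\<close>

lemma skew_derivation_diff_characters:
  assumes "skew_derivation \<chi> \<chi>' d" "character \<chi>" "character \<chi>'"
  shows "skew_derivation \<chi> \<chi>' (\<lambda>x. d x - t * (\<chi> x - \<chi>' x))"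
  using assms by (auto simp: skew_derivation_def character_def clinear_def algebra_simps)

section \<open>Tensor products of functionals\<close>

definition tens :: "('b alg \<Rightarrow> complex) \<Rightarrow> ('c alg \<Rightarrow> complex) \<Rightarrow> ('b \<times> 'c) alg \<Rightarrow> complex"
    where
  "tens f g T = (\<Sum>i\<in>UNIV. \<Sum>j\<in>UNIV. coeff T (i, j) * (f (bvec i) * g (bvec j)))"

lemma clinear_tens: "clinear (tens f g)"
  unfolding clinear_def tens_def by (simp add: sum.distrib sum_distrib_left algebra_simps)

lemma tens_tensor:
  fixes x :: "'b::finite alg" and y :: "'c::finite alg"
  assumes "clinear f" "clinear g"
  shows "tens f g (x \<otimes> y) = f x * g y"
  by (simp add: tens_def clinear_expansion[OF assms(1), of x] clinear_expansion[OF assms(2), of y]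
      sum_product mult_ac)

text \<open>The basis expansion of \<open>T\<close> is a sum of pure tensors, as each coefficient
  can be absorbed into the first factor.\<close>

lemma tensor_induct [case_names zero add tensor]:
  fixes T :: "('b::finite \<times> 'c::finite) alg"
  assumes "P 0" "\<And>S T. P S \<Longrightarrow> P T \<Longrightarrow> P (S + T)" "\<And>x y. P (x \<otimes> y)"
  shows "P T"
proof -
  have *: "P (\<Sum>k\<in>K. (coeff T k *\<^sub>C bvec (fst k)) \<otimes> bvec (snd k))" for K
    by (induction K rule: infinite_finite_induct) (auto intro: assms)
  have "(\<Sum>k\<in>UNIV. (coeff T k *\<^sub>C bvec (fst k)) \<otimes> bvec (snd k)) = T"
    (is "?S = _")
  proof -
    have "?S = (\<Sum>k\<in>UNIV. coeff T k *\<^sub>C bvec k)"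
      by (intro sum.cong refl alg_eqI) (auto simp: prod_eq_iff)
    then show ?thesis
      by (simp flip: bvec_expansion)
  qed
  with *[of UNIV] show ?thesis
    by simp
qed

lemma character_tens:
  assumes "character \<chi>" "character \<psi>"
  shows "character (tens \<chi> \<psi>)"
proof -
  note l = assms[THEN character_clinear]
  have "tens \<chi> \<psi> (S * T) = tens \<chi> \<psi> S * tens \<chi> \<psi> T" for S T
  proof (induction S rule: tensor_induct)
    case (tensor x y)
    show ?case
    proof (induction T rule: tensor_induct)
      case (tensor x' y')
      then show ?case
        by (simp add: tensor_mult tens_tensor l character_mult[OF assms(1)]
            character_mult[OF assms(2)])
    qed (simp_all add: clinear_zero clinear_add clinear_tens algebra_simps)
  qed (simp_all add: clinear_zero clinear_add clinear_tens algebra_simps)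
  then show ?thesis
    using assms by (simp add: character_def clinear_tens tens_tensor tensor_one)
qed

text \<open>The factor seen by \<open>\<psi>\<close> is evaluated multiplicatively, so the Leibniz
  rule of \<open>d\<close> passes to the tensor product. Thus the rules for products and inverses
  apply to \<open>R\<close> and to both sides of the Yang-Baxter equation.\<close>

lemma skew_derivation_tens_left:
  assumes "skew_derivation \<chi> \<chi>' d" "character \<chi>" "character \<chi>'" "character \<psi>"
  shows "skew_derivation (tens \<chi> \<psi>) (tens \<chi>' \<psi>) (tens d \<psi>)"
proof -
  note l = assms(2-4)[THEN character_clinear] skew_derivation_clinear[OF assms(1)]
  have "tens d \<psi> (S * T) = tens d \<psi> S * tens \<chi> \<psi> T + tens \<chi>' \<psi> S * tens d \<psi> T" for S T
  proof (induction S rule: tensor_induct)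
    case (tensor x y)
    show ?case
    proof (induction T rule: tensor_induct)
      case (tensor x' y')
      then show ?case
        by (simp add: tensor_mult tens_tensor l character_mult[OF assms(4)]
            skew_derivation_mult[OF assms(1)] algebra_simps)
    qed (simp_all add: clinear_zero clinear_add clinear_tens algebra_simps)
  qed (simp_all add: clinear_zero clinear_add clinear_tens algebra_simps)
  then show ?thesis
    by (simp add: skew_derivation_def clinear_tens)
qed

lemma skew_derivation_tens_right:
  assumes "skew_derivation \<chi> \<chi>' d" "character \<chi>" "character \<chi>'" "character \<psi>"
  shows "skew_derivation (tens \<psi> \<chi>) (tens \<psi> \<chi>') (tens \<psi> d)"
proof -
  note l = assms(2-4)[THEN character_clinear] skew_derivation_clinear[OF assms(1)]
  have "tens \<psi> d (S * T) = tens \<psi> d S * tens \<psi> \<chi> T + tens \<psi> \<chi>' S * tens \<psi> d T" for S T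
  proof (induction S rule: tensor_induct)
    case (tensor x y)
    show ?case
    proof (induction T rule: tensor_induct)
      case (tensor x' y')
      then show ?case
        by (simp add: tensor_mult tens_tensor l character_mult[OF assms(4)]
            skew_derivation_mult[OF assms(1)] algebra_simps)
    qed (simp_all add: clinear_zero clinear_add clinear_tens algebra_simps)
  qed (simp_all add: clinear_zero clinear_add clinear_tens algebra_simps)
  then show ?thesis
    by (simp add: skew_derivation_def clinear_tens)
qed

text \<open>The leg that \<open>R\<close> leaves free contributes the value at \<open>1\<close>:
  this is \<open>1\<close> for a character, and \<open>0\<close> for a skew derivation between
  characters.\<close>

lemma tens_R12:
  assumes "clinear f" "clinear g" "clinear h"
  shows "tens f (tens g h) (R12 R) = tens f g R * h 1"
proof -
  have "tens f (tens g h) (R12 R)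
      = (\<Sum>i\<in>UNIV. \<Sum>j\<in>UNIV. coeff R (i, j) * (f (bvec i) * (g (bvec j) * h 1)))"
    unfolding R12_def clinear_tsum[OF clinear_tens] by (simp only: tens_tensor assms clinear_tens)
  then show ?thesis
    by (simp add: tens_def sum_distrib_left mult_ac)
qed

lemma tens_R13:
  assumes "clinear f" "clinear g" "clinear h"
  shows "tens f (tens g h) (R13 R) = tens f h R * g 1"
proof -
  have "tens f (tens g h) (R13 R)
      = (\<Sum>i\<in>UNIV. \<Sum>j\<in>UNIV. coeff R (i, j) * (f (bvec i) * (g 1 * h (bvec j))))"
    unfolding R13_def clinear_tsum[OF clinear_tens] by (simp only: tens_tensor assms clinear_tens)
  then show ?thesis
    by (simp add: tens_def sum_distrib_left mult_ac)
qed

lemma tens_R23: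
  assumes "clinear f" "clinear g" "clinear h"
  shows "tens f (tens g h) (R23 R) = tens g h R * f 1"
proof -
  have "tens f (tens g h) (R23 R)
      = (\<Sum>i\<in>UNIV. \<Sum>j\<in>UNIV. coeff R (i, j) * (f 1 * (g (bvec i) * h (bvec j))))"
    unfolding R23_def clinear_tsum[OF clinear_tens] by (simp only: tens_tensor assms clinear_tens)
  then show ?thesis
    by (simp add: tens_def sum_distrib_left mult_ac)
qed

section \<open>Travelling along a diagram\<close>

locale long_knot =
  fixes D :: diagram
  assumes wf: "well_formed D" and arc: "single_arc D"
begin

definition time :: "point \<Rightarrow> nat" where
  "time = the_inv_into {..<card (points D)} ((!) (traversal D))"

lemma level_Suc: "k < length D \<Longrightarrow> level D (Suc k) = above (D ! k) (level D k)"
  by (simp add: level_def take_Suc_conv_app_nth)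

lemma level_0: "level D 0 = [Up]"
  by (simp add: level_def)

lemma level_length: "level D (length D) = [Up]"
  and fits_level: "k < length D \<Longrightarrow> fits (D ! k) (level D k)"
  using wf by (auto simp: well_formed_def)

lemma finite_points: "finite (points D)"
proof -
  have "points D = Sigma {..length D} (\<lambda>k. {..<length (level D k)})"
    by (auto simp: points_def)
  then show ?thesis
    by simp
qed

lemma length_traversal: "length (traversal D) = card (points D)"
  by (simp add: traversal_def)

lemma set_traversal: "set (traversal D) = points D"
  using arc by (simp add: single_arc_def)

text \<open>The list is as long as its set of entries is large, which excludes repetitions. Hence
  \<open>time\<close> is a well-defined inverse of the enumeration.\<close>

lemma distinct_traversal: "distinct (traversal D)"
  by (rule card_distinct) (simp add: length_traversal set_traversal)

lemma inj_on_nth_traversal: "inj_on ((!) (traversal D)) {..<card (points D)}"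
  using distinct_traversal by (auto intro!: inj_on_nth simp: length_traversal)

lemma image_nth_traversal: "(!) (traversal D) ` {..<card (points D)} = points D"
  by (metis length_traversal lessThan_atLeast0 list.set_map map_nth set_traversal set_upt)

lemma traversal_time: "pt \<in> points D \<Longrightarrow> traversal D ! time pt = pt"
  and time_less: "pt \<in> points D \<Longrightarrow> time pt < card (points D)"
  and time_traversal: "n < card (points D) \<Longrightarrow> time (traversal D ! n) = n"
proof -
  note inj = inj_on_nth_traversal and im = image_nth_traversal
  show "traversal D ! time pt = pt" if "pt \<in> points D"
    unfolding time_def by (rule f_the_inv_into_f[OF inj]) (simp add: that im)
  show "time pt < card (points D)" if "pt \<in> points D"
    using the_inv_into_into[OF inj _ subset_refl, of pt] that unfolding time_def im by simp
  show "time (traversal D ! n) = n" if "n < card (points D)"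
    unfolding time_def by (rule the_inv_into_f_f[OF inj]) (simp add: that)
qed

lemma time_inj: "pt \<in> points D \<Longrightarrow> pt' \<in> points D \<Longrightarrow> time pt = time pt' \<longleftrightarrow> pt = pt'"
  by (metis traversal_time)

lemma bij_betw_time: "bij_betw time (points D) {..<card (points D)}"
  by (rule bij_betw_byWitness[where f' = "(!) (traversal D)"])
    (use image_nth_traversal in \<open>auto simp: traversal_time time_traversal time_less\<close>)

lemma traversal_Suc:
  "Suc n < card (points D) \<Longrightarrow> traversal D ! Suc n = next_pt D (traversal D ! n)"
  by (simp add: traversal_def)

lemma time_next:
  assumes "pt \<in> points D" "pt \<noteq> (length D, 0)"
  shows "time (next_pt D pt) = Suc (time pt)"
proof -
  define e where "e = (length D, 0 :: nat)"
  have e: "e \<in> points D" "next_pt D e = e"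
    by (auto simp: e_def points_def level_length next_pt_def)
  \<comment> \<open>The upper end is fixed by \<open>next_pt D\<close>, so an entry following it
    would repeat it.\<close>
  have last: "Suc (time e) = card (points D)"
  proof (rule ccontr)
    assume "Suc (time e) \<noteq> card (points D)"
    then have "Suc (time e) < card (points D)"
      using time_less[OF e(1)] by simp
    then show False
      using traversal_Suc[of "time e"] e time_traversal[of "Suc (time e)"]
      by (simp add: traversal_time)
  qed
  have "time pt \<noteq> time e"
    using assms e(1) by (simp add: time_inj e_def)
  then have "Suc (time pt) < card (points D)"
    using time_less[OF assms(1)] last by linarith
  then show ?thesis
    using traversal_Suc[of "time pt"] assms(1) time_traversal by (metis traversal_time)
qed

lemma time_next_Up:
  assumes "k < length D" "p < length (level D k)" "level D k ! p = Up"
  shows "time (next_pt D (k, p)) = Suc (time (k, p))"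
  using assms by (intro time_next) (auto simp: points_def)

lemma time_next_Down:
  assumes "k \<le> length D" "p < length (level D k)" "level D k ! p = Down"
  shows "time (next_pt D (k, p)) = Suc (time (k, p))"
  using assms level_length by (intro time_next) (auto simp: points_def)

end

fun dir_sign :: "dir \<Rightarrow> int" where
  "dir_sign Up = 1"
| "dir_sign Down = - 1"

text \<open>The sign is the exponent of the bead at a maximum: \<open>\<kappa>\<close> for
  \<open>CW\<close>, its inverse for \<open>CCW\<close>.\<close>

fun turn_sign :: "turn \<Rightarrow> int" where
  "turn_sign CW = 1"
| "turn_sign CCW = - 1"

section \<open>The Whitney formula\<close>

fun pair_sign :: "int \<times> dir \<Rightarrow> int \<times> dir \<Rightarrow> int" where
  "pair_sign (t, d) (t', d') = sgn (t' - t) * dir_sign d * dir_sign d'"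

text \<open>Summed over the pairs of strands of a level, \<open>pair_sign\<close> vanishes at both ends of the knot and
  changes only at crossings, maxima and minima: this is how Whitney's formula is proved.\<close>

fun total_sign :: "(int \<times> dir) list \<Rightarrow> int" where
  "total_sign [] = 0"
| "total_sign (x # xs) = (\<Sum>y\<leftarrow>xs. pair_sign x y) + total_sign xs"

text \<open>Going up through one slice, an upward strand is met one unit later; a downward strand is
  travelled from above, so its upper point is met one unit earlier.\<close>

fun advance :: "int \<times> dir \<Rightarrow> int \<times> dir" where
  "advance (t, d) = (t + dir_sign d, d)"

lemma total_sign_append:
  "total_sign (xs @ ys) = total_sign xs + total_sign ys + (\<Sum>x\<leftarrow>xs. \<Sum>y\<leftarrow>ys. pair_sign x y)"
  by (induction xs) auto

text \<open>Two disjoint pairs of consecutive integers lie entirely on one side of each other, so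
  their order is the same at both ends.\<close>

lemma pair_sign_advance:
  assumes "fst x \<noteq> fst y" "fst (advance x) \<noteq> fst y" "fst x \<noteq> fst (advance y)"
    "fst (advance x) \<noteq> fst (advance y)"
  shows "pair_sign (advance x) (advance y) = pair_sign x y"
  using assms by (cases x; cases y; cases "snd x"; cases "snd y") (auto simp: sgn_if)

lemma distinct_map_appendD:
  assumes "distinct (map f (x # xs) @ map g (x # xs))" "y \<in> set xs"
  shows "f x \<noteq> f y" "g x \<noteq> f y" "f x \<noteq> g y" "g x \<noteq> g y"
  using assms by auto

lemma total_sign_advance:
  assumes "distinct (map fst xs @ map (\<lambda>x. fst (advance x)) xs)"
  shows "total_sign (map advance xs) = total_sign xs"
  using assms
proof (induction xs)
  case (Cons x xs)
  have "pair_sign (advance x) (advance y) = pair_sign x y" if y: "y \<in> set xs" for y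
    by (rule pair_sign_advance) (rule distinct_map_appendD[OF Cons.prems y])+
  then have "(\<Sum>y\<leftarrow>xs. pair_sign (advance x) (advance y)) = (\<Sum>y\<leftarrow>xs. pair_sign x y)"
    by (metis (mono_tags, lifting) map_cong)
  moreover have "total_sign (map advance xs) = total_sign xs"
    by (rule Cons.IH) (use Cons.prems in simp)
  ultimately show ?case
    by (simp add: comp_def)
qed simp

text \<open>Only the pair of \<open>x\<close> and \<open>y\<close> changes its order, and
  \<open>pair_sign\<close> is antisymmetric.\<close>

lemma total_sign_swap:
  "total_sign (xs @ [x, y] @ ys) = total_sign (xs @ [y, x] @ ys) + 2 * pair_sign x y"
proof -
  have "pair_sign y x = - pair_sign x y"
    by (cases x; cases y) (simp add: sgn_if)
  then show ?thesis
    by (simp add: total_sign_append sum_list_addf)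
qed

text \<open>No time of a third strand lies between two consecutive times. As \<open>x\<close> and
  \<open>y\<close> have opposite directions, their contributions with any third strand
  cancel.\<close>

lemma total_sign_insert:
  assumes "snd x \<noteq> snd y" "\<bar>fst x - fst y\<bar> = 1" "fst x \<notin> fst ` set (xs @ ys)"
    "fst y \<notin> fst ` set (xs @ ys)"
  shows "total_sign (xs @ [x, y] @ ys) = total_sign (xs @ ys) + pair_sign x y"
proof -
  have 1: "pair_sign z x + pair_sign z y = 0" "pair_sign x z + pair_sign y z = 0"
    if "z \<in> set (xs @ ys)" for z
  proof -
    have "fst z \<in> fst ` set (xs @ ys)"
      using that by (rule imageI)
    with assms(3,4) have ne: "fst z \<noteq> fst x" "fst z \<noteq> fst y"
      by metis+
    have "dir_sign (snd y) = - dir_sign (snd x)"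
      using assms(1) by (cases "snd x"; cases "snd y") auto
    moreover have "sgn (fst y - fst z) = sgn (fst x - fst z)"
      "sgn (fst z - fst y) = sgn (fst z - fst x)"
      using ne assms(2) by (simp_all add: sgn_if split: if_splits) linarith+
    ultimately show "pair_sign z x + pair_sign z y = 0" "pair_sign x z + pair_sign y z = 0"
      by (cases x; cases y; cases z; simp)+
  qed
  have "(\<Sum>z\<leftarrow>xs. pair_sign z x + pair_sign z y) = (\<Sum>z\<leftarrow>xs. 0)"
    "(\<Sum>z\<leftarrow>ys. pair_sign x z + pair_sign y z) = (\<Sum>z\<leftarrow>ys. 0)"
    by (rule arg_cong[where f = sum_list], rule map_cong[OF refl], simp add: 1)+
  then show ?thesis
    by (simp add: total_sign_append sum_list_addf algebra_simps)
qed

section \<open>Change of the signed pair count across a slice\<close>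

context long_knot
begin

definition strands :: "nat \<Rightarrow> (int \<times> dir) list" where
  "strands k = map (\<lambda>p. (int (time (k, p)), level D k ! p)) [0..<length (level D k)]"

lemma length_strands [simp]: "length (strands k) = length (level D k)"
  by (simp add: strands_def)

lemma nth_strands: "p < length (level D k) \<Longrightarrow> strands k ! p = (int (time (k, p)), level D k ! p)"
  by (simp add: strands_def)

text \<open>Different points have different times. This supplies the distinctness required for
  advancing strands and for inserting a pair of them.\<close>

lemma distinct_strands:
  assumes "k < length D"
  shows "distinct (map fst (strands k) @ map fst (strands (Suc k)))"
proof -
  have "inj_on (\<lambda>p. int (time (j, p))) {..<length (level D j)}" if "j \<le> length D" for j
    using that by (auto simp: inj_on_def time_inj points_def)
  moreover have "time (k, p) \<noteq> time (Suc k, p')"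
    if "p < length (level D k)" "p' < length (level D (Suc k))" for p p'
    using that assms by (simp add: time_inj points_def)
  ultimately show ?thesis
    using assms by (auto simp: strands_def distinct_map comp_def lessThan_atLeast0)
qed

definition left_first :: "nat \<Rightarrow> nat \<Rightarrow> int" where
  "left_first k q = (if time (k, q) < time (k, Suc q) then 1 else - 1)"

text \<open>A crossing exchanges two upward strands, which reverses one pair. A maximum removes a
  pair of sign \<open>- turn_sign t\<close> and a minimum adds one of sign
  \<open>turn_sign t\<close>, so both change the total by \<open>turn_sign t\<close>.\<close>

definition slice_change :: "nat \<Rightarrow> int" where
  "slice_change k = (case D ! k of
      Cross q \<epsilon> \<Rightarrow> - 2 * left_first k q
    | Max q t \<Rightarrow> turn_sign t
    | Min q t \<Rightarrow> turn_sign t)"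

lemma strands_advance:
  assumes "k < length D" "p < length (level D k)" "p' < length (level D (Suc k))"
    and "level D (Suc k) ! p' = level D k ! p"
    and "level D k ! p = Up \<Longrightarrow> next_pt D (k, p) = (Suc k, p')"
    and "level D k ! p = Down \<Longrightarrow> next_pt D (Suc k, p') = (k, p)"
  shows "strands (Suc k) ! p' = advance (strands k ! p)"
  using assms time_next_Up[of k p] time_next_Down[of "Suc k" p']
  by (cases "level D k ! p") (simp_all add: nth_strands)

lemma list_split_pair:
  assumes "Suc q < length xs"
  obtains ys x y zs where "xs = ys @ [x, y] @ zs" "length ys = q"
  using assms that[of "take q xs" "xs ! q" "xs ! Suc q" "drop (Suc (Suc q)) xs"]
  by (simp add: Cons_nth_drop_Suc)

lemma total_sign_Cross:
  assumes k: "k < length D" and D: "D ! k = Cross q \<epsilon>"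
  shows "total_sign (strands (Suc k)) = total_sign (strands k) + slice_change k"
proof -
  note fit = fits_level[OF k, unfolded D, simplified]
  have lev: "level D (Suc k) = level D k"
    using level_Suc[OF k] D by simp
  have adv: "strands (Suc k) ! (if p = q then q + 1 else if p = q + 1 then q else p)
      = advance (strands k ! p)" if "p < length (level D k)" for p
    by (rule strands_advance) (use that fit k D lev in \<open>auto simp: next_pt_def\<close>)
  obtain xs x y ys where S: "strands k = xs @ [x, y] @ ys" and q: "length xs = q"
    by (rule list_split_pair[of q "strands k"]) (use fit in simp)
  have len: "length (level D k) = q + 2 + length ys"
    using arg_cong[OF S, of length] q by simp
  have S1: "strands (Suc k) = map advance (xs @ [y, x] @ ys)"
  proof (rule nth_equalityI)
    show "length (strands (Suc k)) = length (map advance (xs @ [y, x] @ ys))"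
      by (simp add: lev len q)
    fix p assume "p < length (strands (Suc k))"
    then have p: "p < length (level D k)"
      by (simp add: lev)
    consider "p < q" | "p = q" | "p = q + 1" | "p > q + 1"
      by linarith
    then show "strands (Suc k) ! p = map advance (xs @ [y, x] @ ys) ! p"
    proof cases
      case 4
      then obtain m where m: "p = q + 2 + m"
        by (metis Suc_eq_plus1 add_2_eq_Suc' less_eqE Suc_leI)
      then show ?thesis
        using adv[OF p] 4 p q by (simp add: S nth_append len)
    qed (use adv[of q] adv[of "q + 1"] adv[of p] p q in \<open>auto simp: S nth_append len\<close>)
  qed
  \<comment> \<open>Advancing preserves \<open>total_sign\<close>, so only the exchange of
    \<open>x\<close> and \<open>y\<close> counts.\<close>
  have "total_sign (strands (Suc k)) = total_sign (xs @ [y, x] @ ys)"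
    unfolding S1 using distinct_strands[OF k] unfolding S S1
    by (intro total_sign_advance) (auto simp: comp_def)
  moreover have "pair_sign x y = left_first k q"
  proof -
    have xy: "x = (int (time (k, q)), Up)" "y = (int (time (k, Suc q)), Up)"
      using nth_strands[of q k] nth_strands[of "Suc q" k] fit q unfolding S
      by (simp_all add: nth_append)
    have "time (k, q) \<noteq> time (k, Suc q)"
      using fit k by (simp add: time_inj points_def)
    then show ?thesis
      by (auto simp: xy left_first_def sgn_if)
  qed
  ultimately show ?thesis
    unfolding S total_sign_swap[of xs x y] by (simp add: slice_change_def D)
qed

lemma total_sign_Max:
  assumes k: "k < length D" and D: "D ! k = Max q t"
  shows "total_sign (strands (Suc k)) = total_sign (strands k) + slice_change k"
proof -
  note fit = fits_level[OF k, unfolded D, simplified]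
  have lev: "level D (Suc k) = take q (level D k) @ drop (q + 2) (level D k)"
    using level_Suc[OF k] D by simp
  have adv: "strands (Suc k) ! (if p < q then p else p - 2) = advance (strands k ! p)"
    if "p < length (level D k)" "p < q \<or> p \<ge> q + 2" for p
  proof -
    have "Suc (Suc q) \<le> p \<Longrightarrow> Suc (Suc (p - 2)) = p"
      by arith
    then show ?thesis
      by (intro strands_advance)
        (use that fit k D lev in \<open>auto simp: next_pt_def nth_append min_def\<close>)
  qed
  obtain xs x y ys where S: "strands k = xs @ [x, y] @ ys" and q: "length xs = q"
    by (rule list_split_pair[of q "strands k"]) (use fit in simp)
  have len: "length (level D k) = q + 2 + length ys"
    using arg_cong[OF S, of length] q by simp
  have S1: "strands (Suc k) = map advance (xs @ ys)"
  proof (rule nth_equalityI)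
    show "length (strands (Suc k)) = length (map advance (xs @ ys))"
      by (simp add: lev len q)
    fix p assume "p < length (strands (Suc k))"
    then have p: "p < q + length ys"
      by (simp add: lev len)
    show "strands (Suc k) ! p = map advance (xs @ ys) ! p"
    proof (cases "p < q")
      case True
      then show ?thesis
        using adv[of p] p q by (simp add: S nth_append len)
    next
      case False
      then have "(xs @ [x, y] @ ys) ! (p + 2) = ys ! (p - q)"
        using q by (simp add: nth_append Suc_diff_le)
      then show ?thesis
        using adv[of "p + 2"] p q False by (simp add: S nth_append len)
    qed
  qed
  have xy: "x = (int (time (k, q)), level D k ! q)" "y = (int (time (k, Suc q)), level D k ! Suc q)"
    using nth_strands[of q k] nth_strands[of "Suc q" k] fit q unfolding S
    by (simp_all add: nth_append)
  \<comment> \<open>The knot passes from one of the two points directly to the other: from left to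
    right for \<open>CW\<close>, from right to left for \<open>CCW\<close>.\<close>
  have consecutive: "snd x \<noteq> snd y \<and> \<bar>fst x - fst y\<bar> = 1 \<and> pair_sign x y = - turn_sign t"
  proof (cases t)
    case CW
    then have "next_pt D (k, q) = (k, Suc q)"
      using fit k by (simp add: next_pt_def D)
    with CW show ?thesis
      using fit k time_next_Up[of k q] by (simp add: xy)
  next
    case CCW
    then have "next_pt D (k, Suc q) = (k, q)"
      using fit k by (simp add: next_pt_def D)
    with CCW show ?thesis
      using fit k time_next_Up[of k "Suc q"] by (simp add: xy)
  qed
  have "total_sign (strands (Suc k)) = total_sign (xs @ ys)"
    unfolding S1 using distinct_strands[OF k] unfolding S S1
    by (intro total_sign_advance) (auto simp: comp_def)
  moreover have "total_sign (strands k) = total_sign (xs @ ys) + pair_sign x y"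
    unfolding S using consecutive distinct_strands[OF k] unfolding S
    by (intro total_sign_insert) auto
  ultimately show ?thesis
    using consecutive by (simp add: slice_change_def D)
qed

lemma total_sign_Min:
  assumes k: "k < length D" and D: "D ! k = Min q t"
  shows "total_sign (strands (Suc k)) = total_sign (strands k) + slice_change k"
proof -
  note fit = fits_level[OF k, unfolded D, simplified]
  have lev: "level D (Suc k) = take q (level D k) @ turn_dirs t @ drop q (level D k)"
    using level_Suc[OF k] D by simp
  have turn: "length (turn_dirs t) = 2"
    by (cases t) auto
  have adv: "strands (Suc k) ! (if p < q then p else p + 2) = advance (strands k ! p)"
    if "p < length (level D k)" for p
    by (rule strands_advance)
      (use that fit k D lev turn in \<open>auto simp: next_pt_def nth_append min_def\<close>)
  define xs where "xs = take q (strands k)"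
  define ys where "ys = drop q (strands k)"
  define x where "x = strands (Suc k) ! q"
  define y where "y = strands (Suc k) ! Suc q"
  have S: "strands k = xs @ ys" and q: "length xs = q"
    using fit by (simp_all add: xs_def ys_def)
  have len: "length (level D k) = q + length ys"
    using arg_cong[OF S, of length] q by simp
  have S1: "strands (Suc k) = map advance xs @ [x, y] @ map advance ys"
  proof (rule nth_equalityI)
    show "length (strands (Suc k)) = length (map advance xs @ [x, y] @ map advance ys)"
      by (simp add: lev len q turn)
    fix p assume "p < length (strands (Suc k))"
    then have p: "p < q + 2 + length ys"
      by (simp add: lev len turn)
    consider "p < q" | "p = q" | "p = Suc q" | "p \<ge> q + 2"
      by linarith
    then show "strands (Suc k) ! p = (map advance xs @ [x, y] @ map advance ys) ! p"
    proof cases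
      case 1
      then show ?thesis
        using adv[of p] p q by (simp add: S nth_append len)
    next
      case 4
      then obtain m where m: "p = q + 2 + m"
        using less_eqE by blast
      then show ?thesis
        using adv[of "q + m"] p q by (simp add: S nth_append len)
    qed (use q in \<open>simp_all add: x_def y_def nth_append\<close>)
  qed
  have lev1: "level D (Suc k) ! q = turn_dirs t ! 0" "level D (Suc k) ! Suc q = turn_dirs t ! 1"
    "Suc q < length (level D (Suc k))"
    using fit by (simp_all add: lev nth_append turn)
  then have xy: "x = (int (time (Suc k, q)), turn_dirs t ! 0)"
    "y = (int (time (Suc k, Suc q)), turn_dirs t ! 1)"
    by (simp_all add: x_def y_def nth_strands)
  \<comment> \<open>At a minimum the senses are reversed: \<open>CW\<close> runs from right to left,
    \<open>CCW\<close> from left to right.\<close>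
  have consecutive: "snd x \<noteq> snd y \<and> \<bar>fst x - fst y\<bar> = 1 \<and> pair_sign x y = turn_sign t"
  proof (cases t)
    case CW
    then have "next_pt D (Suc k, Suc q) = (Suc k, q)"
      using lev1 k by (simp add: next_pt_def D)
    with CW show ?thesis
      using lev1 k time_next_Down[of "Suc k" "Suc q"] by (simp add: xy)
  next
    case CCW
    then have "next_pt D (Suc k, q) = (Suc k, Suc q)"
      using lev1 k by (simp add: next_pt_def D)
    with CCW show ?thesis
      using lev1 k time_next_Down[of "Suc k" q] by (simp add: xy)
  qed
  have "total_sign (map advance (xs @ ys)) = total_sign (strands k)"
    using distinct_strands[OF k] unfolding S S1
    by (intro total_sign_advance) (auto simp: comp_def)
  moreover have "total_sign (strands (Suc k)) =
      total_sign (map advance xs @ map advance ys) + pair_sign x y"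
    unfolding S1 using consecutive distinct_strands[OF k] unfolding S1
    by (intro total_sign_insert) (simp_all add: image_image image_Un)
  ultimately show ?thesis
    using consecutive by (simp add: slice_change_def D)
qed

text \<open>The sum telescopes, and the single strand at either end of the knot forms no
  pair.\<close>

lemma sum_slice_change: "(\<Sum>k<length D. slice_change k) = 0"
proof -
  have "total_sign (strands n) = (\<Sum>k<n. slice_change k)" if "n \<le> length D" for n
    using that
  proof (induction n)
    case 0
    then show ?case
      by (simp add: strands_def level_0)
  next
    case (Suc n)
    have "total_sign (strands (Suc n)) = total_sign (strands n) + slice_change n"
      using Suc.prems
      by (cases "D ! n") (simp_all add: total_sign_Cross total_sign_Max total_sign_Min)
    with Suc show ?case
      by simp
  qed
  from this[of "length D"] show ?thesis
    by (simp add: strands_def level_length)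
qed

section \<open>Assigning the events to the slices\<close>

text \<open>The event of a maximum or minimum is recorded only at the point where the knot enters it.\<close>

definition max_pt :: "nat \<Rightarrow> nat \<Rightarrow> turn \<Rightarrow> point" where
  "max_pt k q t = (k, if t = CW then q else Suc q)"

definition min_pt :: "nat \<Rightarrow> nat \<Rightarrow> turn \<Rightarrow> point" where
  "min_pt k q t = (Suc k, if t = CW then Suc q else q)"

definition active :: "nat \<Rightarrow> point set" where
  "active k = (case D ! k of
      Cross q \<epsilon> \<Rightarrow> {(k, q), (k, Suc q)}
    | Max q t \<Rightarrow> {max_pt k q t}
    | Min q t \<Rightarrow> {min_pt k q t})"

lemma Cross_pts:
  assumes "k < length D" "D ! k = Cross q \<epsilon>"
  shows "(k, q) \<in> points D" "(k, Suc q) \<in> points D"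
    "level D k ! q = Up" "level D k ! Suc q = Up"
    "events_at D (k, q) = [if \<epsilon> = Pos then Over k else Under k]"
    "events_at D (k, Suc q) = [if \<epsilon> = Pos then Under k else Over k]"
  using assms fits_level[OF assms(1)] by (auto simp: points_def events_at_def)

lemma Max_pts:
  assumes "k < length D" "D ! k = Max q t"
  shows "max_pt k q t \<in> points D" "level D k ! snd (max_pt k q t) = Up"
    "events_at D (max_pt k q t) = [MaxTurn t]"
  using assms fits_level[OF assms(1)]
  by (cases t; auto simp: points_def events_at_def max_pt_def)+

lemma Min_pts:
  assumes "k < length D" "D ! k = Min q t"
  shows "min_pt k q t \<in> points D" "level D (Suc k) ! snd (min_pt k q t) = Down"
    "events_at D (min_pt k q t) = [MinTurn t]"
proof -
  have *: "level D (Suc k) = take q (level D k) @ turn_dirs t @ drop q (level D k)"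
    "q \<le> length (level D k)"
    using assms level_Suc[OF assms(1)] fits_level[OF assms(1)] by simp_all
  show "min_pt k q t \<in> points D" "level D (Suc k) ! snd (min_pt k q t) = Down"
    "events_at D (min_pt k q t) = [MinTurn t]"
    using assms *
    by (cases t; simp add: points_def events_at_def min_pt_def nth_append min_def; fail)+
qed

lemma active_cases:
  "D ! k = Cross q \<epsilon> \<Longrightarrow> active k = {(k, q), (k, Suc q)}"
  "D ! k = Max q t \<Longrightarrow> active k = {max_pt k q t}"
  "D ! k = Min q t \<Longrightarrow> active k = {min_pt k q t}"
  by (simp_all add: active_def)

lemma finite_active: "finite (active k)"
  by (simp add: active_def split: slice.split)

lemma active_subset: "k < length D \<Longrightarrow> active k \<subseteq> points D"
  by (cases "D ! k") (simp_all add: active_cases Cross_pts Max_pts Min_pts)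

text \<open>From an upward point the knot enters the slice above, from a downward point the slice
  below. An active point therefore determines its slice.\<close>

lemma active_slice:
  assumes "k < length D" "pt \<in> active k"
  shows "k = (if level D (fst pt) ! snd pt = Up then fst pt else fst pt - 1)"
proof (cases "D ! k")
  case (Cross q \<epsilon>)
  then show ?thesis
    using assms Cross_pts[OF assms(1) Cross] by (auto simp: active_cases)
next
  case (Max q t)
  then show ?thesis
    using assms Max_pts[OF assms(1) Max] by (auto simp: active_cases max_pt_def)
next
  case (Min q t)
  then show ?thesis
    using assms Min_pts[OF assms(1) Min] by (auto simp: active_cases min_pt_def)
qed

lemma active_disjoint:
  "k < length D \<Longrightarrow> k' < length D \<Longrightarrow> k \<noteq> k' \<Longrightarrow> active k \<inter> active k' = {}"
  using active_slice by (metis disjoint_iff)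

lemma events_at_active:
  assumes "pt \<in> points D" "events_at D pt \<noteq> []"
  shows "\<exists>k<length D. pt \<in> active k"
proof -
  obtain k p where pt: "pt = (k, p)"
    by fastforce
  show ?thesis
  proof (cases "level D k ! p")
    case Up
    then have k: "k < length D"
      using assms by (auto simp: pt points_def events_at_def split: if_splits)
    have "pt \<in> active k"
    proof (cases "D ! k")
      case (Max q t)
      then show ?thesis
        using assms Up k fits_level[OF k]
        by (cases t) (auto simp: pt events_at_def active_def max_pt_def split: if_splits)
    qed (use assms Up k in \<open>auto simp: pt events_at_def active_def split: if_splits\<close>)
    with k show ?thesis
      by blast
  next
    case Down
    \<comment> \<open>Level \<open>0\<close> consists of one upward strand, so a downward point has
      a slice below it.\<close>
    then have k: "0 < k"
      using assms level_0 by (cases k) (auto simp: pt points_def)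
    then have k1: "k - 1 < length D" "Suc (k - 1) = k"
      using assms by (auto simp: pt points_def)
    obtain q t where D: "D ! (k - 1) = Min q t" and q: "p = q \<or> p = Suc q"
      using assms(2) Down by (auto simp: pt events_at_def split: slice.splits if_splits)
    \<comment> \<open>Of the two strands created by the minimum only one is downward; this
      identifies the point as \<open>min_pt\<close>.\<close>
    have "level D k = take q (level D (k - 1)) @ turn_dirs t @ drop q (level D (k - 1))"
      "q \<le> length (level D (k - 1))"
      using D level_Suc[OF k1(1)] fits_level[OF k1(1)] k1(2) by simp_all
    then have "level D k ! q = turn_dirs t ! 0" "level D k ! Suc q = turn_dirs t ! 1"
      by (cases t; simp add: nth_append)+
    then have "pt \<in> active (k - 1)"
      using Down D q k1(2) by (cases t) (auto simp: pt active_def min_pt_def)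
    with k1 show ?thesis
      by blast
  qed
qed

text \<open>The active sets are disjoint and contain every point that carries an event, so a sum
  along the knot becomes a sum over slices.\<close>

lemma sum_points:
  fixes f :: "point \<Rightarrow> 'a::comm_monoid_add"
  assumes "\<And>pt. pt \<in> points D \<Longrightarrow> events_at D pt = [] \<Longrightarrow> f pt = 0"
  shows "(\<Sum>pt\<in>points D. f pt) = (\<Sum>k<length D. \<Sum>pt\<in>active k. f pt)"
proof -
  have "(\<Sum>pt\<in>points D. f pt) = (\<Sum>pt\<in>(\<Union>k<length D. active k). f pt)"
    by (rule sum.mono_neutral_right)
      (use assms events_at_active active_subset finite_points in \<open>blast+\<close>)
  also have "\<dots> = (\<Sum>k<length D. \<Sum>pt\<in>active k. f pt)"
    by (rule sum.UNION_disjoint) (use active_disjoint in \<open>auto simp: finite_active\<close>)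
  finally show ?thesis .
qed

lemma prod_points:
  fixes f :: "point \<Rightarrow> 'a::comm_monoid_mult"
  assumes "\<And>pt. pt \<in> points D \<Longrightarrow> events_at D pt = [] \<Longrightarrow> f pt = 1"
  shows "(\<Prod>pt\<in>points D. f pt) = (\<Prod>k<length D. \<Prod>pt\<in>active k. f pt)"
proof -
  have "(\<Prod>pt\<in>points D. f pt) = (\<Prod>pt\<in>(\<Union>k<length D. active k). f pt)"
    by (rule prod.mono_neutral_right)
      (use assms events_at_active active_subset finite_points in \<open>blast+\<close>)
  also have "\<dots> = (\<Prod>k<length D. \<Prod>pt\<in>active k. f pt)"
    by (rule prod.UNION_disjoint) (use active_disjoint in \<open>auto simp: finite_active\<close>)
  finally show ?thesis .
qed

end

lemma sum_list_concat_map: "(\<Sum>y\<leftarrow>concat (map g xs). f y) = (\<Sum>x\<leftarrow>xs. \<Sum>y\<leftarrow>g x. f y)"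
  for f :: "'a \<Rightarrow> 'b::comm_monoid_add"
  by (induction xs) auto

text \<open>Maxima and minima get opposite signs, so that the two halves of a full rotation
  cancel.\<close>

fun turn_balance :: "event \<Rightarrow> int" where
  "turn_balance (MaxTurn t) = turn_sign t"
| "turn_balance (MinTurn t) = - turn_sign t"
| "turn_balance _ = 0"

lemma full_rotations_balance: "full_rotations es \<Longrightarrow> (\<Sum>e\<leftarrow>es. turn_balance e) = 0"
  by (induction es rule: full_rotations.induct) auto

locale rotational_knot = long_knot +
  assumes rotations: "full_rotations (events D)"
begin

text \<open>The left side is the clockwise rotation number. By \<open>sum_slice_change\<close>,
  maxima and minima together count twice the crossing sum; as they come in full rotations, the
  maxima make up half of this.\<close>

lemma Whitney:
  "(\<Sum>k<length D. case D ! k of Cross q \<epsilon> \<Rightarrow> 0 | Max q t \<Rightarrow> turn_sign t | Min q t \<Rightarrow> 0) =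
   (\<Sum>k<length D. case D ! k of Cross q \<epsilon> \<Rightarrow> left_first k q | Max q t \<Rightarrow> 0 | Min q t \<Rightarrow> 0)"
  (is "?max = ?cross")
proof -
  define mins where
    "mins = (\<Sum>k<length D. case D ! k of Cross q \<epsilon> \<Rightarrow> 0 | Max q t \<Rightarrow> 0 | Min q t \<Rightarrow> turn_sign t)"
  have "?max + mins - 2 * ?cross = (\<Sum>k<length D. slice_change k)"
    unfolding mins_def sum_distrib_left sum.distrib[symmetric] sum_subtractf[symmetric]
    by (intro sum.cong refl) (simp add: slice_change_def split: slice.split)
  also have "\<dots> = 0"
    by (rule sum_slice_change)
  finally have "?max + mins = 2 * ?cross"
    by simp
  moreover have "?max = mins"
  proof -
    \<comment> \<open>The balance, which vanishes along the knot, is evaluated slice by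
      slice.\<close>
    define f where "f = (\<lambda>pt. \<Sum>e\<leftarrow>events_at D pt. turn_balance e)"
    have "(\<Sum>e\<leftarrow>events D. turn_balance e) = (\<Sum>pt\<leftarrow>traversal D. f pt)"
      unfolding events_def f_def by (rule sum_list_concat_map)
    also have "\<dots> = (\<Sum>pt\<in>points D. f pt)"
      by (simp add: distinct_traversal sum_list_distinct_conv_sum_set set_traversal)
    also have "\<dots> = (\<Sum>k<length D. \<Sum>pt\<in>active k. f pt)"
      by (rule sum_points) (simp add: f_def)
    also have "\<dots> = (\<Sum>k<length D. (case D ! k of Cross q \<epsilon> \<Rightarrow> 0 | Max q t \<Rightarrow> turn_sign t | Min q t \<Rightarrow> 0)
        - (case D ! k of Cross q \<epsilon> \<Rightarrow> 0 | Max q t \<Rightarrow> 0 | Min q t \<Rightarrow> turn_sign t))"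
      (is "_ = (\<Sum>k<_. ?g k)")
    proof (rule sum.cong[OF refl])
      fix k assume "k \<in> {..<length D}"
      then have k: "k < length D"
        by simp
      show "(\<Sum>pt\<in>active k. f pt) = ?g k"
        using k by (cases "D ! k") (simp_all add: active_cases f_def Cross_pts Max_pts Min_pts)
    qed
    finally show ?thesis
      using full_rotations_balance[OF rotations] by (simp add: mins_def sum_subtractf)
  qed
  ultimately show ?thesis
    by simp
qed

end

section \<open>The state sum\<close>

lemma character_prod_list:
  assumes "character \<chi>"
  shows "\<chi> (prod_list (map p (rev [0..<n]))) = (\<Prod>m<n. \<chi> (p m))"
  by (induction n) (simp_all add: character_one[OF assms] character_mult[OF assms])

text \<open>The iterated Leibniz rule. Factor \<open>0\<close> stands rightmost, so the factors
  below \<open>j\<close> are seen by \<open>\<chi>\<close> and those above by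
  \<open>\<chi>'\<close>.\<close>

lemma skew_derivation_prod_list:
  assumes "skew_derivation \<chi> \<chi>' d" "character \<chi>" "character \<chi>'"
  shows "d (prod_list (map p (rev [0..<n]))) =
    (\<Sum>j<n. \<Prod>m<n. (if m < j then \<chi> else if m = j then d else \<chi>') (p m))"
proof (induction n)
  case (Suc n)
  let ?F = "\<lambda>j m. (if m < j then \<chi> else if m = j then d else \<chi>') (p m)"
  have "d (prod_list (map p (rev [0..<Suc n]))) =
      d (p n) * \<chi> (prod_list (map p (rev [0..<n]))) + \<chi>' (p n) * (\<Sum>j<n. \<Prod>m<n. ?F j m)"
    by (simp add: skew_derivation_mult[OF assms(1)] Suc)
  also have "\<dots> = (\<Prod>m<Suc n. ?F n m) + (\<Sum>j<n. \<Prod>m<Suc n. ?F j m)"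
    by (simp add: character_prod_list[OF assms(2)] sum_distrib_left mult.commute)
  finally show ?case
    by simp
qed (simp add: skew_derivation_one[OF assms])

lemma prod_list_concat_rev:
  "prod_list (map b (rev (concat (map g xs)))) =
    prod_list (map (\<lambda>x. prod_list (map b (rev (g x)))) (rev xs))"
  for b :: "'a \<Rightarrow> 'b::monoid_mult"
  by (induction xs) auto

fun turn_bead :: "'b::alg_basis alg \<Rightarrow> turn \<Rightarrow> 'b alg" where
  "turn_bead \<kappa> CCW = inverse \<kappa>"
| "turn_bead \<kappa> CW = \<kappa>"

lemma bead_MaxTurn: "bead \<kappa> c (MaxTurn t) = turn_bead \<kappa> t"
  by (cases t) simp_all

context long_knot
begin

definition point_bead :: "'b::alg_basis alg \<Rightarrow> (nat \<Rightarrow> 'b \<times> 'b) \<Rightarrow> point \<Rightarrow> 'b alg" where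
  "point_bead \<kappa> c pt = prod_list (map (bead \<kappa> c) (rev (events_at D pt)))"

text \<open>The value of \<open>d\<close> on a product of beads is a sum over the point at which \<open>d\<close> is applied; the
  beads met earlier are evaluated by \<open>\<chi>\<close> and those met later by \<open>\<chi>'\<close>.\<close>

definition split_at :: "('a \<Rightarrow> complex) \<Rightarrow> ('a \<Rightarrow> complex) \<Rightarrow> ('a \<Rightarrow> complex) \<Rightarrow> point \<Rightarrow> point
    \<Rightarrow> 'a \<Rightarrow> complex" where
  "split_at \<chi> \<chi>' d u pt = (if time pt < time u then \<chi> else if time pt = time u then d else \<chi>')"

lemma prod_list_events:
  "prod_list (map (bead \<kappa> c) (rev (events D))) =
    prod_list (map (\<lambda>n. point_bead \<kappa> c (traversal D ! n)) (rev [0..<card (points D)]))"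
proof -
  have "map (\<lambda>n. point_bead \<kappa> c (traversal D ! n)) (rev [0..<card (points D)]) =
      map (point_bead \<kappa> c) (rev (map ((!) (traversal D)) [0..<length (traversal D)]))"
    by (simp add: length_traversal rev_map comp_def)
  then show ?thesis
    by (simp add: events_def prod_list_concat_rev map_nth point_bead_def[abs_def])
qed

lemma prod_time:
  "(\<Prod>n<card (points D). F n (traversal D ! n)) = (\<Prod>pt\<in>points D. F (time pt) pt)"
  for F :: "nat \<Rightarrow> point \<Rightarrow> complex"
  by (subst prod.reindex_bij_betw[OF bij_betw_time, symmetric])
    (intro prod.cong refl, simp add: traversal_time)

lemma sum_time:
  "(\<Sum>n<card (points D). F n) = (\<Sum>pt\<in>points D. F (time pt))"
  for F :: "nat \<Rightarrow> complex"
  by (rule sum.reindex_bij_betw[OF bij_betw_time, symmetric])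

lemma character_events:
  assumes "character \<chi>"
  shows "\<chi> (prod_list (map (bead \<kappa> c) (rev (events D)))) =
    (\<Prod>pt\<in>points D. \<chi> (point_bead \<kappa> c pt))"
  unfolding prod_list_events character_prod_list[OF assms] by (rule prod_time)

lemma skew_derivation_events:
  assumes "skew_derivation \<chi> \<chi>' d" "character \<chi>" "character \<chi>'"
  shows "d (prod_list (map (bead \<kappa> c) (rev (events D)))) =
    (\<Sum>u\<in>points D. \<Prod>pt\<in>points D. split_at \<chi> \<chi>' d u pt (point_bead \<kappa> c pt))"
  unfolding prod_list_events skew_derivation_prod_list[OF assms] split_at_def sum_time
  by (subst prod_time) simp

text \<open>The contribution of slice \<open>k\<close> to the state sum, if the bead at the point \<open>pt\<close> is evaluated
  by the functional \<open>f pt\<close>.\<close>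

definition slice_value :: "('b::alg_basis \<times> 'b) alg \<Rightarrow> 'b alg \<Rightarrow> (point \<Rightarrow> 'b alg \<Rightarrow> complex)
    \<Rightarrow> nat \<Rightarrow> complex" where
  "slice_value R \<kappa> f k = (case D ! k of
      Cross q \<epsilon> \<Rightarrow> if \<epsilon> = Pos then tens (f (k, q)) (f (k, Suc q)) R
                  else tens (f (k, Suc q)) (f (k, q)) (inverse R)
    | Max q t \<Rightarrow> f (max_pt k q t) (turn_bead \<kappa> t)
    | Min q t \<Rightarrow> f (min_pt k q t) 1)"

text \<open>The contribution for one fixed index pair \<open>ij\<close>. Weighted by the
  coefficients of \<open>R\<close> or \<open>inverse R\<close> and summed over \<open>ij\<close>, it
  gives \<open>slice_value\<close> at a crossing; at other slices the two agree.\<close>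

definition local_value :: "'b::alg_basis alg \<Rightarrow> (point \<Rightarrow> 'b alg \<Rightarrow> complex) \<Rightarrow> nat \<Rightarrow> 'b \<times> 'b
    \<Rightarrow> complex" where
  "local_value \<kappa> f k ij = (case D ! k of
      Cross q \<epsilon> \<Rightarrow> if \<epsilon> = Pos then f (k, q) (bvec (fst ij)) * f (k, Suc q) (bvec (snd ij))
                  else f (k, Suc q) (bvec (fst ij)) * f (k, q) (bvec (snd ij))
    | Max q t \<Rightarrow> f (max_pt k q t) (turn_bead \<kappa> t)
    | Min q t \<Rightarrow> f (min_pt k q t) 1)"

lemma prod_point_bead:
  assumes "\<And>pt. pt \<in> points D \<Longrightarrow> events_at D pt = [] \<Longrightarrow> f pt 1 = 1"
  shows "(\<Prod>pt\<in>points D. f pt (point_bead \<kappa> c pt)) = (\<Prod>k<length D. local_value \<kappa> f k (c k))"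
proof -
  have "(\<Prod>pt\<in>points D. f pt (point_bead \<kappa> c pt)) =
      (\<Prod>k<length D. \<Prod>pt\<in>active k. f pt (point_bead \<kappa> c pt))"
    by (rule prod_points) (simp add: assms point_bead_def)
  also have "\<dots> = (\<Prod>k<length D. local_value \<kappa> f k (c k))"
  proof (rule prod.cong[OF refl])
    fix k assume "k \<in> {..<length D}"
    then have k: "k < length D"
      by simp
    show "(\<Prod>pt\<in>active k. f pt (point_bead \<kappa> c pt)) = local_value \<kappa> f k (c k)"
    proof (cases "D ! k")
      case (Cross q \<epsilon>)
      then show ?thesis
        using k by (cases \<epsilon>)
          (simp_all add: active_cases Cross_pts point_bead_def local_value_def)
    qed (use k in \<open>simp_all add: active_cases Max_pts Min_pts point_bead_def local_value_def
        bead_MaxTurn\<close>)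
  qed
  finally show ?thesis .
qed

lemma crossings_partition:
  "crossings D Pos \<union> crossings D Neg \<subseteq> {..<length D}"
  "crossings D Pos \<inter> crossings D Neg = {}"
  by (auto simp: crossings_def)

lemma finite_crossings [simp]: "finite (crossings D \<epsilon>)"
  by (simp add: crossings_def)

text \<open>Each index choice affects only its own crossing, so the distributive law turns the sum
  over all choices into a product of sums over single index pairs.\<close>

lemma state_sum:
  fixes R :: "('b::alg_basis \<times> 'b) alg"
  assumes "\<And>pt. pt \<in> points D \<Longrightarrow> events_at D pt = [] \<Longrightarrow> f pt 1 = 1"
  shows "(\<Sum>c \<in> (crossings D Pos \<union> crossings D Neg) \<rightarrow>\<^sub>E UNIV.
      (\<Prod>k\<in>crossings D Pos. coeff R (c k)) * (\<Prod>k\<in>crossings D Neg. coeff (inverse R) (c k))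
        * (\<Prod>pt\<in>points D. f pt (point_bead \<kappa> c pt)))
    = (\<Prod>k<length D. slice_value R \<kappa> f k)" (is "?lhs = _")
proof -
  define K where "K = crossings D Pos \<union> crossings D Neg"
  have K: "K \<subseteq> {..<length D}" "finite K"
    using crossings_partition(1) by (simp_all add: K_def)
  define w where "w k = coeff (if k \<in> crossings D Pos then R else inverse R)" for k
  have w: "(\<Prod>k\<in>crossings D Pos. coeff R (c k)) * (\<Prod>k\<in>crossings D Neg. coeff (inverse R) (c k))
      = (\<Prod>k\<in>K. w k (c k))" for c
  proof -
    have "(\<Prod>k\<in>K. w k (c k)) = (\<Prod>k\<in>crossings D Pos. w k (c k)) * (\<Prod>k\<in>crossings D Neg. w k (c k))"
      unfolding K_def by (rule prod.union_disjoint) (simp_all add: crossings_partition)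
    also have "(\<Prod>k\<in>crossings D Neg. w k (c k)) = (\<Prod>k\<in>crossings D Neg. coeff (inverse R) (c k))"
      by (intro prod.cong refl) (use crossings_partition(2) in \<open>auto simp: w_def\<close>)
    finally show ?thesis
      by (simp add: w_def)
  qed
  have off: "local_value \<kappa> f k ij = slice_value R \<kappa> f k" if "k \<in> {..<length D} - K" for k ij
    using that by (auto simp: local_value_def slice_value_def K_def crossings_def
        split: slice.split intro: sign.exhaust)
  have on: "(\<Sum>ij\<in>UNIV. w k ij * local_value \<kappa> f k ij) = slice_value R \<kappa> f k" if "k \<in> K" for k
  proof -
    have tens_UNIV: "tens g h T = (\<Sum>ij\<in>UNIV. coeff T ij * (g (bvec (fst ij)) * h (bvec (snd ij))))"
      for g h and T :: "('b \<times> 'b) alg"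
      by (simp add: tens_def sum.cartesian_product case_prod_beta flip: UNIV_Times_UNIV)
    show ?thesis
      using that by (auto simp: K_def w_def crossings_def local_value_def slice_value_def tens_UNIV)
  qed
  have "?lhs = (\<Sum>c \<in> K \<rightarrow>\<^sub>E UNIV. (\<Prod>k\<in>{..<length D} - K. slice_value R \<kappa> f k)
      * (\<Prod>k\<in>K. w k (c k) * local_value \<kappa> f k (c k)))"
    unfolding w unfolding K_def[symmetric]
  proof (rule sum.cong[OF refl])
    fix c :: "nat \<Rightarrow> 'b \<times> 'b"
    have "(\<Prod>pt\<in>points D. f pt (point_bead \<kappa> c pt)) =
      (\<Prod>k\<in>{..<length D} - K. local_value \<kappa> f k (c k)) * (\<Prod>k\<in>K. local_value \<kappa> f k (c k))"
      by (simp add: prod_point_bead assms prod.subset_diff[OF K(1)])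
    also have "(\<Prod>k\<in>{..<length D} - K. local_value \<kappa> f k (c k)) =
        (\<Prod>k\<in>{..<length D} - K. slice_value R \<kappa> f k)"
      by (intro prod.cong refl off)
    finally show "(\<Prod>k\<in>K. w k (c k)) * (\<Prod>pt\<in>points D. f pt (point_bead \<kappa> c pt)) =
        (\<Prod>k\<in>{..<length D} - K. slice_value R \<kappa> f k)
          * (\<Prod>k\<in>K. w k (c k) * local_value \<kappa> f k (c k))"
      by (simp add: prod.distrib)
  qed
  also have "\<dots> = (\<Prod>k\<in>{..<length D} - K. slice_value R \<kappa> f k)
      * (\<Prod>k\<in>K. \<Sum>ij\<in>UNIV. w k ij * local_value \<kappa> f k ij)"
    by (subst prod_sum_PiE) (simp_all add: K(2) sum_distrib_left)
  also have "\<dots> = (\<Prod>k<length D. slice_value R \<kappa> f k)"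
    by (simp add: on prod.subset_diff[OF K(1)])
  finally show ?thesis .
qed

lemma clinear_universal_inv:
  assumes "clinear F"
  shows "F (universal_inv R \<kappa> D) = (\<Sum>c \<in> (crossings D Pos \<union> crossings D Neg) \<rightarrow>\<^sub>E UNIV.
      (\<Prod>k\<in>crossings D Pos. coeff R (c k)) * (\<Prod>k\<in>crossings D Neg. coeff (inverse R) (c k))
        * F (prod_list (map (bead \<kappa> c) (rev (events D)))))"
  by (simp add: universal_inv_def clinear_sum[OF assms] clinear_scaleC[OF assms])

lemma character_universal_inv:
  assumes "character \<chi>"
  shows "\<chi> (universal_inv R \<kappa> D) = (\<Prod>k<length D. slice_value R \<kappa> (\<lambda>_. \<chi>) k)"
  unfolding clinear_universal_inv[OF character_clinear[OF assms]] character_events[OF assms]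
  by (rule state_sum) (simp add: character_one[OF assms])

lemma skew_derivation_universal_inv:
  assumes "skew_derivation \<chi> \<chi>' d" "character \<chi>" "character \<chi>'"
  shows "d (universal_inv R \<kappa> D) =
    (\<Sum>j<length D. \<Sum>u\<in>active j. \<Prod>k<length D. slice_value R \<kappa> (split_at \<chi> \<chi>' d u) k)"
proof -
  let ?C = "(crossings D Pos \<union> crossings D Neg) \<rightarrow>\<^sub>E UNIV"
  let ?w = "\<lambda>c. (\<Prod>k\<in>crossings D Pos. coeff R (c k)) * (\<Prod>k\<in>crossings D Neg. coeff (inverse R) (c k))"
  let ?P = "\<lambda>u c. \<Prod>pt\<in>points D. split_at \<chi> \<chi>' d u pt (point_bead \<kappa> c pt)"
  have "d (universal_inv R \<kappa> D) = (\<Sum>u\<in>points D. \<Sum>c\<in>?C. ?w c * ?P u c)"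
    unfolding clinear_universal_inv[OF skew_derivation_clinear[OF assms(1)]]
      skew_derivation_events[OF assms] sum_distrib_left
    by (rule sum.swap)
  also have "\<dots> = (\<Sum>j<length D. \<Sum>u\<in>active j. \<Sum>c\<in>?C. ?w c * ?P u c)"
  \<comment> \<open>A point without events carries the bead \<open>1\<close>, on which
    \<open>d\<close> vanishes.\<close>
  proof (rule sum_points)
    fix u assume u: "u \<in> points D" "events_at D u = []"
    have "?P u c = 0" for c
      using u finite_points
      by (intro prod_zero)
        (auto intro!: bexI[of _ u] simp: split_at_def point_bead_def skew_derivation_one[OF assms])
    then show "(\<Sum>c\<in>?C. ?w c * ?P u c) = 0"
      by simp
  qed
  also have "\<dots> = (\<Sum>j<length D. \<Sum>u\<in>active j. \<Prod>k<length D. slice_value R \<kappa> (split_at \<chi> \<chi>' d u) k)"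
  proof (intro sum.cong refl state_sum)
    fix j u pt
    assume j: "j \<in> {..<length D}" and u: "u \<in> active j"
      and pt: "pt \<in> points D" "events_at D pt = []"
    \<comment> \<open>Since \<open>u\<close> carries an event, a point without events is never the
      one where \<open>d\<close> is applied, and its bead \<open>1\<close> is seen by a
      character.\<close>
    have "events_at D u \<noteq> []"
      using j u by (cases "D ! j") (auto simp: active_cases Cross_pts Max_pts Min_pts)
    then have "pt \<noteq> u" "u \<in> points D"
      using pt active_subset j u by auto
    then show "split_at \<chi> \<chi>' d u pt 1 = 1"
      using pt by (simp add: split_at_def time_inj character_one assms)
  qed
  finally show ?thesis .
qed

end

section \<open>XC-structures seen by characters and skew derivations\<close>

lemma tens_inner_left:
  "tens (\<lambda>x. d x - t * (\<chi> x - \<chi>' x)) \<psi> T = tens d \<psi> T - t * (tens \<chi> \<psi> T - tens \<chi>' \<psi> T)"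
  by (simp add: tens_def algebra_simps sum.distrib sum_subtractf sum_distrib_left)

lemma tens_inner_right:
  "tens \<psi> (\<lambda>x. d x - t * (\<chi> x - \<chi>' x)) T = tens \<psi> d T - t * (tens \<psi> \<chi> T - tens \<psi> \<chi>' T)"
  by (simp add: tens_def algebra_simps sum.distrib sum_subtractf sum_distrib_left)

lemma character_power_int:
  assumes "character \<chi>" "invertible x"
  shows "\<chi> (x powi n) = \<chi> x powi n"
proof -
  have "\<chi> (y ^ m) = \<chi> y ^ m" for y m
    by (induction m) (simp_all add: character_one[OF assms(1)] character_mult[OF assms(1)])
  then show ?thesis
    by (simp add: power_int_def character_inverse[OF assms])
qed

lemma skew_derivation_power_int_zero:
  assumes "skew_derivation \<chi> \<chi>' d" "character \<chi>" "character \<chi>'" "invertible x" "d x = 0"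
  shows "d (x powi n) = 0"
proof -
  have "d (y ^ m) = 0" if "d y = 0" for y m
    using that
    by (induction m) (simp_all add: skew_derivation_one[OF assms(1-3)] skew_derivation_mult[OF assms(1)])
  then show ?thesis
    using assms(5) by (simp add: power_int_def skew_derivation_inverse[OF assms(1-4)])
qed

text \<open>On powers of such an \<open>x\<close> the functional acts like an ordinary derivation;
  the logarithmic derivative \<open>d x / \<chi> x\<close> changes sign under inversion, which
  covers negative exponents.\<close>

lemma skew_derivation_power_int:
  assumes "skew_derivation \<chi> \<chi>' d" "character \<chi>" "character \<chi>'" "invertible x" "\<chi> x = \<chi>' x"
  shows "d (x powi n) = of_int n * (d x / \<chi> x) * \<chi> x powi n"
proof -
  have pow: "d (y ^ m) = of_nat m * (d y / \<chi> y) * \<chi> y ^ m" if "\<chi> y = \<chi>' y" "\<chi> y \<noteq> 0" for y m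
  proof (induction m)
    case (Suc m)
    have "\<chi> (y ^ m) = \<chi> y ^ m"
      by (induction m) (simp_all add: character_one[OF assms(2)] character_mult[OF assms(2)])
    with Suc that show ?case
      by (simp add: skew_derivation_mult[OF assms(1)] field_simps)
  qed (simp add: skew_derivation_one[OF assms(1-3)])
  note nz = character_inverse[OF assms(2,4)] character_inverse[OF assms(3,4)]
  show ?thesis
  proof (cases "n \<ge> 0")
    case True
    then show ?thesis
      using pow[of x "nat n"] assms(5) nz by (simp add: power_int_def)
  next
    case False
    then show ?thesis
      using pow[of "inverse x" "nat (- n)"] assms(5) nz
      by (simp add: power_int_def skew_derivation_inverse[OF assms(1-4)] field_simps)
  qed
qed

section \<open>Relations imposed on the beads by the axioms\<close>

locale XC =
  fixes R :: "('b::alg_basis \<times> 'b) alg" and \<kappa> :: "'b alg"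
  assumes XC: "XC_structure R \<kappa>"
begin

lemma invertible_R: "invertible R" and invertible_kappa: "invertible \<kappa>"
  using XC by (simp_all add: XC_structure_def)

lemma XC0: "R * (\<kappa> \<otimes> \<kappa>) = (\<kappa> \<otimes> \<kappa>) * R"
proof -
  have "R * (\<kappa> \<otimes> \<kappa>) = (\<kappa> \<otimes> \<kappa>) * R * (inverse \<kappa> \<otimes> inverse \<kappa>) * (\<kappa> \<otimes> \<kappa>)"
    using XC by (simp add: XC_structure_def)
  also have "\<dots> = (\<kappa> \<otimes> \<kappa>) * R"
    by (simp add: mult.assoc tensor_mult invertible_inverse[OF invertible_kappa] flip: tensor_one)
  finally show ?thesis .
qed

lemma nu_eq: "nu R \<kappa> = tsum R (\<lambda>\<alpha> \<beta>. \<alpha> * inverse \<kappa> * \<beta>)"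
  using XC by (simp add: XC_structure_def nu_def)

lemma XC3: "R12 R * R13 R * R23 R = R23 R * R13 R * R12 R"
  using XC by (simp add: XC_structure_def)

lemma tens_R_nonzero: "character \<chi> \<Longrightarrow> character \<psi> \<Longrightarrow> tens \<chi> \<psi> R \<noteq> 0"
  by (rule character_inverse(1)[OF character_tens invertible_R])

lemma tens_inverse_R:
  "character \<chi> \<Longrightarrow> character \<psi> \<Longrightarrow> tens \<chi> \<psi> (inverse R) = inverse (tens \<chi> \<psi> R)"
  by (rule character_inverse(2)[OF character_tens invertible_R])

lemma character_nu:
  assumes "character \<chi>"
  shows "\<chi> (nu R \<kappa>) = \<chi> \<kappa> * tens \<chi> \<chi> R"
  unfolding nu_def clinear_tsum[OF character_clinear[OF assms]]
  by (simp add: character_mult[OF assms] tens_def sum_distrib_left mult_ac)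

text \<open>Both sides of (XC1f) contain the non-zero factor \<open>tens \<chi> \<chi> R\<close>;
  cancelling it leaves \<open>\<chi> \<kappa> = \<chi> (inverse \<kappa>)\<close>.\<close>

lemma character_kappa:
  assumes "character \<chi>"
  shows "\<chi> \<kappa> * \<chi> \<kappa> = 1"
proof -
  have "\<chi> (nu R \<kappa>) = \<chi> (inverse \<kappa>) * tens \<chi> \<chi> R"
    unfolding nu_eq clinear_tsum[OF character_clinear[OF assms]]
    by (simp add: character_mult[OF assms] tens_def sum_distrib_left mult_ac)
  then show ?thesis
    using tens_R_nonzero[OF assms assms] character_inverse[OF assms invertible_kappa]
    by (simp add: character_nu[OF assms] field_simps)
qed

lemma character_kappa_cases: "character \<chi> \<Longrightarrow> \<chi> \<kappa> = 1 \<or> \<chi> \<kappa> = - 1"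
  using character_kappa by (simp add: square_eq_1_iff)

end

locale XC_skew = XC R \<kappa> for R :: "('b::alg_basis \<times> 'b) alg" and \<kappa> :: "'b alg" +
  fixes \<chi> \<chi>' d :: "'b alg \<Rightarrow> complex"
  assumes skew: "skew_derivation \<chi> \<chi>' d" and char: "character \<chi>" "character \<chi>'"
begin

lemma skew_nu:
  "d (nu R \<kappa>) = \<chi> \<kappa> * tens \<chi> d R + d \<kappa> * tens \<chi> \<chi>' R + \<chi>' \<kappa> * tens d \<chi>' R"
  unfolding nu_def clinear_tsum[OF skew_derivation_clinear[OF skew]]
  by (simp add: character_mult char skew_derivation_mult[OF skew] tens_def sum_distrib_left
      sum.distrib algebra_simps)

text \<open>Obtained from the other side of (XC1f); its comparison with \<open>skew_nu\<close>
  relates the two orders in which the strands of a crossing can be met.\<close>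

lemma skew_nu_alt:
  "d (nu R \<kappa>) = \<chi> (inverse \<kappa>) * tens d \<chi> R + d (inverse \<kappa>) * tens \<chi>' \<chi> R
    + \<chi>' (inverse \<kappa>) * tens \<chi>' d R"
  unfolding nu_eq clinear_tsum[OF skew_derivation_clinear[OF skew]]
  by (simp add: character_mult char skew_derivation_mult[OF skew] tens_def sum_distrib_left
      sum.distrib algebra_simps)

text \<open>Evaluate (XC0) by \<open>tens d \<psi>\<close> and cancel
  \<open>\<psi> \<kappa>\<close>.\<close>

lemma XC0_left:
  assumes "character \<psi>"
  shows "tens d \<psi> R * (\<chi> \<kappa> - \<chi>' \<kappa>) = d \<kappa> * (tens \<chi> \<psi> R - tens \<chi>' \<psi> R)"
proof -
  note lin = character_clinear[OF assms] char[THEN character_clinear] skew_derivation_clinear[OF skew]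
  have "tens d \<psi> R * (\<chi> \<kappa> * \<psi> \<kappa>) + tens \<chi>' \<psi> R * (d \<kappa> * \<psi> \<kappa>)
      = d \<kappa> * \<psi> \<kappa> * tens \<chi> \<psi> R + \<chi>' \<kappa> * \<psi> \<kappa> * tens d \<psi> R"
    using arg_cong[OF XC0, of "tens d \<psi>"]
    by (simp add: skew_derivation_mult[OF skew_derivation_tens_left[OF skew char assms]]
        tens_tensor lin)
  then have "\<psi> \<kappa> * (tens d \<psi> R * (\<chi> \<kappa> - \<chi>' \<kappa>)) = \<psi> \<kappa> * (d \<kappa> * (tens \<chi> \<psi> R - tens \<chi>' \<psi> R))"
    by (simp add: algebra_simps)
  then show ?thesis
    using character_inverse(1)[OF assms invertible_kappa] by simp
qed

lemma XC0_right:
  assumes "character \<psi>"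
  shows "tens \<psi> d R * (\<chi> \<kappa> - \<chi>' \<kappa>) = d \<kappa> * (tens \<psi> \<chi> R - tens \<psi> \<chi>' R)"
proof -
  note lin = character_clinear[OF assms] char[THEN character_clinear] skew_derivation_clinear[OF skew]
  have "tens \<psi> d R * (\<psi> \<kappa> * \<chi> \<kappa>) + tens \<psi> \<chi>' R * (\<psi> \<kappa> * d \<kappa>)
      = \<psi> \<kappa> * d \<kappa> * tens \<psi> \<chi> R + \<psi> \<kappa> * \<chi>' \<kappa> * tens \<psi> d R"
    using arg_cong[OF XC0, of "tens \<psi> d"]
    by (simp add: skew_derivation_mult[OF skew_derivation_tens_right[OF skew char assms]]
        tens_tensor lin)
  then have "\<psi> \<kappa> * (tens \<psi> d R * (\<chi> \<kappa> - \<chi>' \<kappa>)) = \<psi> \<kappa> * (d \<kappa> * (tens \<psi> \<chi> R - tens \<psi> \<chi>' R))"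
    by (simp add: algebra_simps)
  then show ?thesis
    using character_inverse(1)[OF assms invertible_kappa] by simp
qed

text \<open>The parts of degree one of the Yang-Baxter equation, with \<open>d\<close> applied to one tensor factor.\<close>

lemma tens_YBE_left:
  assumes "character \<phi>" "character \<psi>"
  shows "tens d \<phi> R * (tens \<chi> \<psi> R - tens \<chi>' \<psi> R) = tens d \<psi> R * (tens \<chi> \<phi> R - tens \<chi>' \<phi> R)"
proof -
  note lin = assms[THEN character_clinear] char[THEN character_clinear] skew_derivation_clinear[OF skew]
  note one = assms[THEN character_one] char[THEN character_one] skew_derivation_one[OF skew char]
  note c = character_tens[OF assms]
  have "tens d \<phi> R * tens \<chi> \<psi> R * tens \<phi> \<psi> R + tens \<chi>' \<phi> R * tens d \<psi> R * tens \<phi> \<psi> R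
      = tens \<phi> \<psi> R * tens d \<psi> R * tens \<chi> \<phi> R + tens \<phi> \<psi> R * tens \<chi>' \<psi> R * tens d \<phi> R"
    using arg_cong[OF XC3, of "tens d (tens \<phi> \<psi>)"]
    by (simp add: skew_derivation_mult[OF skew_derivation_tens_left[OF skew char c]]
        character_mult[OF character_tens[OF char(1) c]] character_mult[OF character_tens[OF char(2) c]]
        tens_R12 tens_R13 tens_R23 lin one algebra_simps)
  then have "tens \<phi> \<psi> R * (tens d \<phi> R * (tens \<chi> \<psi> R - tens \<chi>' \<psi> R))
      = tens \<phi> \<psi> R * (tens d \<psi> R * (tens \<chi> \<phi> R - tens \<chi>' \<phi> R))"
    by (simp add: algebra_simps)
  then show ?thesis
    using tens_R_nonzero[OF assms] by simp
qed

lemma tens_YBE_right: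
  assumes "character \<phi>" "character \<psi>"
  shows "tens \<phi> d R * (tens \<psi> \<chi> R - tens \<psi> \<chi>' R) = tens \<psi> d R * (tens \<phi> \<chi> R - tens \<phi> \<chi>' R)"
proof -
  note lin = assms[THEN character_clinear] char[THEN character_clinear] skew_derivation_clinear[OF skew]
  note one = assms[THEN character_one] char[THEN character_one] skew_derivation_one[OF skew char]
  note s = skew_derivation_tens_right[OF skew char assms(2)]
  note c = character_tens[OF assms(2) char(1)] character_tens[OF assms(2) char(2)]
  have "tens \<phi> \<psi> R * tens \<phi> d R * tens \<psi> \<chi> R + tens \<phi> \<psi> R * tens \<phi> \<chi>' R * tens \<psi> d R
      = tens \<psi> d R * tens \<phi> \<chi> R * tens \<phi> \<psi> R + tens \<psi> \<chi>' R * tens \<phi> d R * tens \<phi> \<psi> R"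
    using arg_cong[OF XC3, of "tens \<phi> (tens \<psi> d)"]
    by (simp add: skew_derivation_mult[OF skew_derivation_tens_right[OF s c assms(1)]]
        character_mult[OF character_tens[OF assms(1) c(1)]]
        character_mult[OF character_tens[OF assms(1) c(2)]]
        tens_R12 tens_R13 tens_R23 lin one algebra_simps)
  then have "tens \<phi> \<psi> R * (tens \<phi> d R * (tens \<psi> \<chi> R - tens \<psi> \<chi>' R))
      = tens \<phi> \<psi> R * (tens \<psi> d R * (tens \<phi> \<chi> R - tens \<phi> \<chi>' R))"
    by (simp add: algebra_simps)
  then show ?thesis
    using tens_R_nonzero[OF assms] by simp
qed

text \<open>With \<open>d\<close> on the middle leg, the values of \<open>d\<close> on the two legs
  of \<open>R\<close> become linked, so that one constant \<open>t\<close> can serve both.\<close>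

lemma tens_YBE_middle:
  assumes "character \<phi>" "character \<psi>"
  shows "tens \<phi> d R * (tens \<chi> \<psi> R - tens \<chi>' \<psi> R) = tens d \<psi> R * (tens \<phi> \<chi> R - tens \<phi> \<chi>' R)"
proof -
  note lin = assms[THEN character_clinear] char[THEN character_clinear] skew_derivation_clinear[OF skew]
  note one = assms[THEN character_one] char[THEN character_one] skew_derivation_one[OF skew char]
  note s = skew_derivation_tens_left[OF skew char assms(2)]
  note c = character_tens[OF char(1) assms(2)] character_tens[OF char(2) assms(2)]
  have "tens \<phi> d R * tens \<phi> \<psi> R * tens \<chi> \<psi> R + tens \<phi> \<chi>' R * tens \<phi> \<psi> R * tens d \<psi> R
      = tens d \<psi> R * tens \<phi> \<psi> R * tens \<phi> \<chi> R + tens \<chi>' \<psi> R * tens \<phi> \<psi> R * tens \<phi> d R"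
    using arg_cong[OF XC3, of "tens \<phi> (tens d \<psi>)"]
    by (simp add: skew_derivation_mult[OF skew_derivation_tens_right[OF s c assms(1)]]
        character_mult[OF character_tens[OF assms(1) c(1)]]
        character_mult[OF character_tens[OF assms(1) c(2)]]
        tens_R12 tens_R13 tens_R23 lin one algebra_simps)
  then have "tens \<phi> \<psi> R * (tens \<phi> d R * (tens \<chi> \<psi> R - tens \<chi>' \<psi> R))
      = tens \<phi> \<psi> R * (tens d \<psi> R * (tens \<phi> \<chi> R - tens \<phi> \<chi>' R))"
    by (simp add: algebra_simps)
  then show ?thesis
    using tens_R_nonzero[OF assms] by simp
qed

text \<open>Either \<open>d - t (\<chi> - \<chi>')\<close> vanishes on all beads for some \<open>t\<close>, or \<open>\<chi>\<close> and \<open>\<chi>'\<close> cannot be told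
  apart on the beads.\<close>

lemma inner_or_uniform:
  obtains
    (inner) t where "d \<kappa> = t * (\<chi> \<kappa> - \<chi>' \<kappa>)"
      "\<And>\<psi>. \<psi> \<in> {\<chi>, \<chi>'} \<Longrightarrow> tens d \<psi> R = t * (tens \<chi> \<psi> R - tens \<chi>' \<psi> R)"
      "\<And>\<psi>. \<psi> \<in> {\<chi>, \<chi>'} \<Longrightarrow> tens \<psi> d R = t * (tens \<psi> \<chi> R - tens \<psi> \<chi>' R)"
  | (uniform) "\<chi> \<kappa> = \<chi>' \<kappa>" "tens \<chi> \<chi>' R = tens \<chi> \<chi> R" "tens \<chi>' \<chi> R = tens \<chi> \<chi> R"
      "tens \<chi>' \<chi>' R = tens \<chi> \<chi> R"
proof (cases "\<chi> \<kappa> = \<chi>' \<kappa>")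
  case False
  \<comment> \<open>The first equation leaves no other choice; (XC0) then yields the remaining
    ones.\<close>
  define t where "t = d \<kappa> / (\<chi> \<kappa> - \<chi>' \<kappa>)"
  have "character \<psi>" if "\<psi> \<in> {\<chi>, \<chi>'}" for \<psi>
    using that char by auto
  then show ?thesis
    using False XC0_left XC0_right by (intro inner[of t]) (simp_all add: t_def divide_simps)
next
  case eq: True
  have ch: "character \<psi>" if "\<psi> \<in> {\<chi>, \<chi>'}" for \<psi>
    using that char by auto
  \<comment> \<open>\<open>\<rho>\<close> and \<open>\<sigma>\<close> measure how
    \<open>\<chi>\<close> and \<open>\<chi>'\<close> differ on the first and on the second leg of
    \<open>R\<close>.\<close>
  define \<rho> where "\<rho> = (\<lambda>\<psi>. tens \<chi> \<psi> R - tens \<chi>' \<psi> R)"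
  define \<sigma> where "\<sigma> = (\<lambda>\<psi>. tens \<psi> \<chi> R - tens \<psi> \<chi>' R)"
  consider \<phi> where "\<phi> \<in> {\<chi>, \<chi>'}" "\<rho> \<phi> \<noteq> 0" | \<phi> where "\<phi> \<in> {\<chi>, \<chi>'}" "\<sigma> \<phi> \<noteq> 0"
    | "\<rho> \<chi> = 0" "\<rho> \<chi>' = 0" "\<sigma> \<chi> = 0"
    by blast
  then show ?thesis
  proof cases
    case (1 \<phi>)
    \<comment> \<open>A single \<open>\<phi>\<close> with \<open>\<rho> \<phi> \<noteq> 0\<close>
      fixes \<open>t\<close>; the Yang-Baxter relations carry it over to every \<open>\<psi>\<close>
      and to the other leg.\<close>
    define t where "t = tens d \<phi> R / \<rho> \<phi>"
    have k: "d \<kappa> = 0"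
      using XC0_left[OF ch[OF 1(1)]] 1(2) eq by (simp add: \<rho>_def)
    show ?thesis
    proof (rule inner[of t])
      fix \<psi> assume \<psi>: "\<psi> \<in> {\<chi>, \<chi>'}"
      show "tens d \<psi> R = t * (tens \<chi> \<psi> R - tens \<chi>' \<psi> R)"
        using tens_YBE_left[OF ch[OF 1(1)] ch[OF \<psi>]] 1(2) by (simp add: t_def \<rho>_def field_simps)
      show "tens \<psi> d R = t * (tens \<psi> \<chi> R - tens \<psi> \<chi>' R)"
        using tens_YBE_middle[OF ch[OF \<psi>] ch[OF 1(1)]] 1(2) by (simp add: t_def \<rho>_def field_simps)
    qed (simp add: k eq)
  next
    case (2 \<phi>)
    define t where "t = tens \<phi> d R / \<sigma> \<phi>"
    have k: "d \<kappa> = 0"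
      using XC0_right[OF ch[OF 2(1)]] 2(2) eq by (simp add: \<sigma>_def)
    show ?thesis
    proof (rule inner[of t])
      fix \<psi> assume \<psi>: "\<psi> \<in> {\<chi>, \<chi>'}"
      show "tens d \<psi> R = t * (tens \<chi> \<psi> R - tens \<chi>' \<psi> R)"
        using tens_YBE_middle[OF ch[OF 2(1)] ch[OF \<psi>]] 2(2) by (simp add: t_def \<sigma>_def field_simps)
      show "tens \<psi> d R = t * (tens \<psi> \<chi> R - tens \<psi> \<chi>' R)"
        using tens_YBE_right[OF ch[OF 2(1)] ch[OF \<psi>]] 2(2) by (simp add: t_def \<sigma>_def field_simps)
    qed (simp add: k eq)
  next
    \<comment> \<open>\<open>\<rho>\<close> equates values with a common second leg and
      \<open>\<sigma> \<chi>\<close> links the two second legs, so all four values agree.\<close>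
    case 3
    then show ?thesis
      using eq by (intro uniform) (simp_all add: \<rho>_def \<sigma>_def)
  qed
qed

end

section \<open>The invariant seen by characters and skew derivations\<close>

fun sign_int :: "sign \<Rightarrow> int" where
  "sign_int Pos = 1"
| "sign_int Neg = - 1"

lemma writhe_sum:
  "writhe D = (\<Sum>k<length D. case D ! k of Cross q \<epsilon> \<Rightarrow> sign_int \<epsilon> | Max q t \<Rightarrow> 0 | Min q t \<Rightarrow> 0)"
proof -
  have card: "int (card (crossings D \<epsilon>)) = (\<Sum>k<length D. if k \<in> crossings D \<epsilon> then 1 else 0)" for \<epsilon>
  proof -
    have "crossings D \<epsilon> = {k \<in> {..<length D}. k \<in> crossings D \<epsilon>}"
      by (auto simp: crossings_def)
    then have "int (card (crossings D \<epsilon>)) = (\<Sum>k\<in>{k \<in> {..<length D}. k \<in> crossings D \<epsilon>}. 1)"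
      by simp
    also have "\<dots> = (\<Sum>k<length D. if k \<in> crossings D \<epsilon> then 1 else 0)"
      by (rule sum.inter_filter) simp
    finally show ?thesis .
  qed
  show ?thesis
    unfolding writhe_def card sum_subtractf[symmetric]
  proof (intro sum.cong refl)
    fix k assume "k \<in> {..<length D}"
    then show "(if k \<in> crossings D Pos then 1 else 0) - (if k \<in> crossings D Neg then 1 else 0) =
        (case D ! k of Cross q \<epsilon> \<Rightarrow> sign_int \<epsilon> | Max q t \<Rightarrow> 0 | Min q t \<Rightarrow> 0)"
      by (auto simp: crossings_def split: slice.split) (metis sign.exhaust sign_int.simps)+
  qed
qed

lemma power_int_sum: "c \<noteq> 0 \<Longrightarrow> (\<Prod>k\<in>A. c powi f k) = c powi (\<Sum>k\<in>A. f k)"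
  for c :: complex
  by (induction A rule: infinite_finite_induct) (simp_all add: power_int_add)

lemma (in long_knot) left_first_cases: "left_first k q = 1 \<or> left_first k q = - 1"
  by (simp add: left_first_def)

lemma (in long_knot) Cross_times:
  assumes "k < length D" "D ! k = Cross q \<epsilon>"
  shows "time (k, q) \<noteq> time (k, Suc q)"
  using Cross_pts[OF assms] by (simp add: time_inj)

section \<open>Evaluation by characters\<close>

locale XC_knot = XC R \<kappa> + rotational_knot D
  for R :: "('b::alg_basis \<times> 'b) alg" and \<kappa> :: "'b alg" and D :: diagram
begin

lemma character_universal_inv_nu:
  assumes "character \<chi>"
  shows "\<chi> (universal_inv R \<kappa> D) = \<chi> (nu R \<kappa>) powi writhe D"
proof -
  define l where "l = \<chi> \<kappa>"
  define r where "r = tens \<chi> \<chi> R"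
  have l: "l = 1 \<or> l = - 1" and l0: "l \<noteq> 0"
    using character_kappa_cases[OF assms] by (auto simp: l_def)
  have r0: "r \<noteq> 0"
    by (simp add: r_def tens_R_nonzero assms)
  let ?max = "\<lambda>k. case D ! k of Cross q \<epsilon> \<Rightarrow> 0 | Max q t \<Rightarrow> turn_sign t | Min q t \<Rightarrow> 0"
  let ?cross = "\<lambda>k. case D ! k of Cross q \<epsilon> \<Rightarrow> left_first k q | Max q t \<Rightarrow> 0 | Min q t \<Rightarrow> 0"
  let ?wr = "\<lambda>k. case D ! k of Cross q \<epsilon> \<Rightarrow> sign_int \<epsilon> | Max q t \<Rightarrow> 0 | Min q t \<Rightarrow> 0"
  have turn: "\<chi> (turn_bead \<kappa> t) = l powi turn_sign t" for t
    by (cases t) (simp_all add: l_def character_inverse[OF assms invertible_kappa])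
  have "\<chi> (universal_inv R \<kappa> D) = (\<Prod>k<length D. r powi ?wr k * l powi ?max k)"
    unfolding character_universal_inv[OF assms]
  proof (rule prod.cong[OF refl])
    fix k
    show "slice_value R \<kappa> (\<lambda>_. \<chi>) k = r powi ?wr k * l powi ?max k"
    proof (cases "D ! k")
      case (Cross q \<epsilon>)
      then show ?thesis
        by (cases \<epsilon>) (simp_all add: slice_value_def tens_inverse_R assms flip: r_def)
    qed (simp_all add: slice_value_def turn character_one[OF assms])
  qed
  also have "\<dots> = r powi writhe D * (\<Prod>k<length D. l powi ?cross k)"
    by (simp add: prod.distrib power_int_sum r0 l0 writhe_sum Whitney)
  \<comment> \<open>As \<open>l\<close> is \<open>1\<close> or \<open>- 1\<close>, only the parity
    of the exponent matters, and at each crossing both exponents are odd.\<close>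
  also have "(\<Prod>k<length D. l powi ?cross k) = (\<Prod>k<length D. l powi ?wr k)"
  proof (rule prod.cong[OF refl])
    fix k
    show "l powi ?cross k = l powi ?wr k"
    proof (cases "D ! k")
      case (Cross q \<epsilon>)
      then show ?thesis
        using l left_first_cases[of k q] by (cases \<epsilon>) auto
    qed simp_all
  qed
  also have "\<dots> = l powi writhe D"
    by (simp add: power_int_sum l0 writhe_sum)
  finally show ?thesis
    by (simp add: character_nu assms l_def r_def power_int_mult_distrib mult.commute)
qed

end

section \<open>Evaluation by skew derivations\<close>

locale XC_skew_knot = XC_skew R \<kappa> \<chi> \<chi>' d + XC_knot R \<kappa> D
  for R :: "('b::alg_basis \<times> 'b) alg" and \<kappa> :: "'b alg"
    and \<chi> \<chi>' d :: "'b alg \<Rightarrow> complex" and D :: diagram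
begin

text \<open>Every term of the Leibniz expansion contains the slice to which \<open>d\<close> is
  applied. There the other strand of a crossing is seen by \<open>\<chi>\<close> or
  \<open>\<chi>'\<close>, so this factor vanishes.\<close>

lemma skew_universal_inv_zero:
  assumes "d \<kappa> = 0" "\<And>\<psi>. \<psi> \<in> {\<chi>, \<chi>'} \<Longrightarrow> tens d \<psi> R = 0"
    "\<And>\<psi>. \<psi> \<in> {\<chi>, \<chi>'} \<Longrightarrow> tens \<psi> d R = 0"
  shows "d (universal_inv R \<kappa> D) = 0" "d (nu R \<kappa>) = 0"
proof -
  show "d (nu R \<kappa>) = 0"
    by (simp add: skew_nu assms)
  have ch: "character \<psi>" if "\<psi> \<in> {\<chi>, \<chi>'}" for \<psi>
    using that char by auto
  have inv: "tens d \<psi> (inverse R) = 0" "tens \<psi> d (inverse R) = 0" if "\<psi> \<in> {\<chi>, \<chi>'}" for \<psi>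
    using skew_derivation_inverse[OF skew_derivation_tens_left[OF skew char ch[OF that]]
        character_tens[OF char(1) ch[OF that]] character_tens[OF char(2) ch[OF that]] invertible_R]
      skew_derivation_inverse[OF skew_derivation_tens_right[OF skew char ch[OF that]]
        character_tens[OF ch[OF that] char(1)] character_tens[OF ch[OF that] char(2)] invertible_R]
    by (simp_all add: assms(2)[OF that] assms(3)[OF that])
  have "d (turn_bead \<kappa> t) = 0" for t
    by (cases t) (simp_all add: assms skew_derivation_inverse[OF skew char invertible_kappa])
  then have "slice_value R \<kappa> (split_at \<chi> \<chi>' d u) j = 0" if "j < length D" "u \<in> active j" for j u
    using that assms(2,3) inv Cross_times Cross_times[symmetric]
    by (cases "D ! j")
      (auto simp: active_cases slice_value_def split_at_def skew_derivation_one[OF skew char])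
  then have zero: "(\<Prod>k<length D. slice_value R \<kappa> (split_at \<chi> \<chi>' d u) k) = 0"
    if "j < length D" "u \<in> active j" for j u
    using that by (intro prod_zero bexI[of _ j]) simp_all
  show "d (universal_inv R \<kappa> D) = 0"
    unfolding skew_derivation_universal_inv[OF skew char] by (intro sum.neutral ballI zero) auto
qed

text \<open>All slices away from \<open>d\<close> have the same value in every term, so
  \<open>d\<close> divided by \<open>\<chi>\<close> is a sum of local logarithmic
  derivatives.\<close>

lemma skew_universal_inv_uniform:
  assumes \<kappa>: "\<chi> \<kappa> = \<chi>' \<kappa>" and R: "tens \<chi> \<chi>' R = tens \<chi> \<chi> R" "tens \<chi>' \<chi> R = tens \<chi> \<chi> R"
      "tens \<chi>' \<chi>' R = tens \<chi> \<chi> R"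
  shows "d (universal_inv R \<kappa> D) =
    of_int (writhe D) * (d (nu R \<kappa>) / \<chi> (nu R \<kappa>)) * \<chi> (nu R \<kappa>) powi writhe D"
proof -
  define l where "l = \<chi> \<kappa>"
  define r where "r = tens \<chi> \<chi> R"
  define m where "m = d \<kappa>"
  \<comment> \<open>Up to the factor \<open>r\<close>, this is what a positive crossing contributes
    if its overstrand is met first.\<close>
  define A where "A = (tens d \<chi>' R + tens \<chi> d R) / r"
  note rs = R[folded r_def] r_def[symmetric]
  have l: "l * l = 1" "l \<noteq> 0" "inverse l = l" "\<chi>' \<kappa> = l"
    using character_kappa_cases[OF char(1)] \<kappa> by (auto simp: l_def)
  have r0: "r \<noteq> 0"
    by (simp add: r_def tens_R_nonzero char)
  have inv\<kappa>: "\<chi> (inverse \<kappa>) = l" "\<chi>' (inverse \<kappa>) = l" "d (inverse \<kappa>) = - m"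
    using l by (simp_all add: character_inverse char invertible_kappa l_def[symmetric] m_def
        skew_derivation_inverse[OF skew char invertible_kappa])
  have nu: "d (nu R \<kappa>) / \<chi> (nu R \<kappa>) = A + m * l"
    using l r0 by (simp add: skew_nu character_nu[OF char(1)] rs A_def field_simps
        flip: l_def m_def)
  \<comment> \<open>If the understrand is met first, the contribution exceeds the former by a fixed
    multiple of \<open>m * l\<close>.\<close>
  have XC1f: "tens d \<chi> R + tens \<chi>' d R = r * (A + 2 * (m * l))"
  proof -
    have *: "l * (tens d \<chi> R + tens \<chi>' d R) = l * (tens d \<chi>' R + tens \<chi> d R) + 2 * m * r"
      using skew_nu skew_nu_alt l inv\<kappa> by (simp add: rs algebra_simps flip: l_def m_def)
    have "(l * l) * (tens d \<chi> R + tens \<chi>' d R) = (l * l) * (tens d \<chi>' R + tens \<chi> d R) + 2 * m * r * l"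
      using arg_cong[OF *, of "(*) l"] by (simp add: algebra_simps)
    then show ?thesis
      using l r0 by (simp add: A_def field_simps)
  qed
  have d_right: "tens \<chi> d R = r * A - tens d \<chi>' R"
    "tens \<chi>' d R = r * (A + 2 * (m * l)) - tens d \<chi> R"
    using r0 XC1f by (simp_all add: A_def eq_diff_eq add.commute)
  have ch: "character \<psi>" if "\<psi> \<in> {\<chi>, \<chi>'}" for \<psi>
    using that char by auto
  have unif: "tens \<phi> \<psi> R = r" "tens \<phi> \<psi> (inverse R) = inverse r"
    if "\<phi> \<in> {\<chi>, \<chi>'}" "\<psi> \<in> {\<chi>, \<chi>'}" for \<phi> \<psi>
    using that by (auto simp: rs tens_inverse_R char)
  have dinv: "tens d \<psi> (inverse R) = - tens d \<psi> R / (r * r)"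
      "tens \<psi> d (inverse R) = - tens \<psi> d R / (r * r)" if "\<psi> \<in> {\<chi>, \<chi>'}" for \<psi>
  proof -
    have "tens \<chi> \<psi> R = r" "tens \<chi>' \<psi> R = r" "tens \<psi> \<chi> R = r" "tens \<psi> \<chi>' R = r"
      using that by (auto simp: rs)
    then show "tens d \<psi> (inverse R) = - tens d \<psi> R / (r * r)"
      "tens \<psi> d (inverse R) = - tens \<psi> d R / (r * r)"
      using skew_derivation_inverse[OF skew_derivation_tens_left[OF skew char ch[OF that]]
          character_tens[OF char(1) ch[OF that]] character_tens[OF char(2) ch[OF that]] invertible_R]
        skew_derivation_inverse[OF skew_derivation_tens_right[OF skew char ch[OF that]]
          character_tens[OF ch[OF that] char(1)] character_tens[OF ch[OF that] char(2)] invertible_R]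
      by simp_all
  qed
  define v where "v = slice_value R \<kappa> (\<lambda>_. \<chi>)"
  have v_eq: "v k = (case D ! k of Cross q \<epsilon> \<Rightarrow> if \<epsilon> = Pos then r else inverse r
      | Max q t \<Rightarrow> l | Min q t \<Rightarrow> 1)" for k
  proof (cases "D ! k")
    case (Max q t)
    then show ?thesis
      by (cases t) (simp_all add: v_def slice_value_def inv\<kappa> l_def)
  qed (simp_all add: v_def slice_value_def unif character_one char)
  have v0: "v k \<noteq> 0" for k
    using r0 l by (simp add: v_eq split: slice.split)
  \<comment> \<open>The contribution of slice \<open>j\<close> relative to \<open>v j\<close>. At a
    crossing the two orders of passage are written as their mean plus or minus \<open>m * l\<close>,
    so that the dependence on the order is carried by \<open>left_first\<close>.\<close>
  define q where "q j = (case D ! j of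
      Cross p \<epsilon> \<Rightarrow> of_int (sign_int \<epsilon>) * (A + m * l) - m * l * of_int (left_first j p)
    | Max p t \<Rightarrow> m * l * of_int (turn_sign t)
    | Min p t \<Rightarrow> 0)" for j
  \<comment> \<open>Away from slice \<open>j\<close> only \<open>\<chi>\<close> and
    \<open>\<chi>'\<close> occur, possibly mixed at a crossing, and uniformity gives
    \<open>v k\<close> for each mixture.\<close>
  have other: "slice_value R \<kappa> (split_at \<chi> \<chi>' d u) k = v k"
    if "j < length D" "u \<in> active j" "k < length D" "k \<noteq> j" for j u k
  proof -
    have "split_at \<chi> \<chi>' d u pt \<in> {\<chi>, \<chi>'}" if "pt \<in> active k" for pt
    proof -
      have "pt \<noteq> u" "pt \<in> points D" "u \<in> points D"
        using that \<open>u \<in> active j\<close> \<open>j < length D\<close> \<open>k < length D\<close> \<open>k \<noteq> j\<close>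
          active_disjoint[of j k] active_subset by blast+
      then show ?thesis
        by (simp add: split_at_def time_inj)
    qed
    note f = this
    show ?thesis
    proof (cases "D ! k")
      case (Cross q \<epsilon>)
      then show ?thesis
        using f by (simp add: v_eq slice_value_def unif active_cases)
    next
      case (Max q t)
      then have "split_at \<chi> \<chi>' d u (max_pt k q t) (turn_bead \<kappa> t) = l"
        using f[of "max_pt k q t"] inv\<kappa> l l_def
        by (cases t) (auto simp: active_cases)
      then show ?thesis
        by (simp add: Max v_eq slice_value_def)
    next
      case (Min q t)
      then show ?thesis
        using f[of "min_pt k q t"] by (auto simp: v_eq slice_value_def active_cases character_one char)
    qed
  qed
  have own: "(\<Sum>u\<in>active j. slice_value R \<kappa> (split_at \<chi> \<chi>' d u) j) = v j * q j"
    if j: "j < length D" for j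
  proof (cases "D ! j")
    case (Cross p \<epsilon>)
    have ne: "time (j, p) \<noteq> time (j, Suc p)"
      by (rule Cross_times[OF j Cross])
    have "(\<Sum>u\<in>active j. slice_value R \<kappa> (split_at \<chi> \<chi>' d u) j) =
        slice_value R \<kappa> (split_at \<chi> \<chi>' d (j, p)) j + slice_value R \<kappa> (split_at \<chi> \<chi>' d (j, Suc p)) j"
      by (simp add: active_cases(1)[OF Cross])
    also have "\<dots> = v j * q j"
    proof (cases "time (j, p) < time (j, Suc p)")
      case True
      then show ?thesis
        using r0
        by (cases \<epsilon>) (simp_all add: Cross slice_value_def split_at_def v_eq q_def left_first_def
            dinv d_right field_simps)
    next
      case False
      with ne have "time (j, Suc p) < time (j, p)"
        by simp
      then show ?thesis
        using r0
        by (cases \<epsilon>) (simp_all add: Cross slice_value_def split_at_def v_eq q_def left_first_def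
            dinv d_right field_simps)
    qed
    finally show ?thesis .
  next
    case (Max p t)
    then show ?thesis
      using l inv\<kappa> by (cases t) (simp_all add: active_cases slice_value_def split_at_def v_eq q_def
          flip: m_def)
  next
    case (Min p t)
    then show ?thesis
      by (simp add: active_cases slice_value_def split_at_def v_eq q_def
          skew_derivation_one[OF skew char])
  qed
  have "d (universal_inv R \<kappa> D) = (\<Sum>j<length D. (\<Prod>k<length D. v k) * q j)"
    unfolding skew_derivation_universal_inv[OF skew char]
  proof (rule sum.cong[OF refl])
    fix j assume j: "j \<in> {..<length D}"
    have "(\<Sum>u\<in>active j. \<Prod>k<length D. slice_value R \<kappa> (split_at \<chi> \<chi>' d u) k)
        = (\<Sum>u\<in>active j. slice_value R \<kappa> (split_at \<chi> \<chi>' d u) j * (\<Prod>k\<in>{..<length D} - {j}. v k))"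
      using j by (intro sum.cong refl) (simp add: prod.remove[OF _ j] other)
    also have "\<dots> = v j * q j * (\<Prod>k\<in>{..<length D} - {j}. v k)"
      using j by (simp add: own flip: sum_distrib_right)
    also have "\<dots> = (\<Prod>k<length D. v k) * q j"
      by (simp add: prod.remove[OF _ j])
    finally show "(\<Sum>u\<in>active j. \<Prod>k<length D. slice_value R \<kappa> (split_at \<chi> \<chi>' d u) k)
        = (\<Prod>k<length D. v k) * q j" .
  qed
  also have "\<dots> = \<chi> (nu R \<kappa>) powi writhe D * (\<Sum>j<length D. q j)"
    by (simp add: v_def character_universal_inv[OF char(1), symmetric] character_universal_inv_nu char
        flip: sum_distrib_left)
  also have "(\<Sum>j<length D. q j) = of_int (writhe D) * (A + m * l)"
  proof -
    let ?max = "\<lambda>k. case D ! k of Cross q \<epsilon> \<Rightarrow> 0 | Max q t \<Rightarrow> turn_sign t | Min q t \<Rightarrow> 0"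
    let ?cross = "\<lambda>k. case D ! k of Cross q \<epsilon> \<Rightarrow> left_first k q | Max q t \<Rightarrow> 0 | Min q t \<Rightarrow> 0"
    let ?wr = "\<lambda>k. case D ! k of Cross q \<epsilon> \<Rightarrow> sign_int \<epsilon> | Max q t \<Rightarrow> 0 | Min q t \<Rightarrow> 0"
    \<comment> \<open>The last term sums to rotation number minus crossing sum, which is zero by
      Whitney's formula.\<close>
    have "q j = of_int (?wr j) * (A + m * l) + m * l * (of_int (?max j) - of_int (?cross j))" for j
      by (simp add: q_def split: slice.split)
    then have "(\<Sum>j<length D. q j) = of_int (writhe D) * (A + m * l)
        + m * l * (of_int (\<Sum>j<length D. ?max j) - of_int (\<Sum>j<length D. ?cross j))"
      by (simp only: writhe_sum sum.distrib of_int_sum sum_distrib_left[symmetric]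
          sum_distrib_right[symmetric] sum_subtractf)
    then show ?thesis
      by (simp only: Whitney) simp
  qed
  finally show ?thesis
    by (simp add: nu)
qed

lemma skew_universal_inv_nu:
  assumes "invertible (nu R \<kappa>)"
  shows "d (universal_inv R \<kappa> D) = d (nu R \<kappa> powi writhe D)"
proof (cases rule: inner_or_uniform)
  case (inner t)
  \<comment> \<open>\<open>d'\<close> vanishes on all beads, hence on the invariant and on the
    powers of \<open>nu\<close>; the difference \<open>d - d'\<close> is a combination of
    characters, for which the claim is known.\<close>
  define d' where "d' = (\<lambda>x. d x - t * (\<chi> x - \<chi>' x))"
  interpret inner: XC_skew_knot R \<kappa> \<chi> \<chi>' d' D
    by unfold_locales (simp_all add: d'_def skew_derivation_diff_characters skew char)
  have "d' \<kappa> = 0" "\<And>\<psi>. \<psi> \<in> {\<chi>, \<chi>'} \<Longrightarrow> tens d' \<psi> R = 0" "\<And>\<psi>. \<psi> \<in> {\<chi>, \<chi>'} \<Longrightarrow> tens \<psi> d' R = 0"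
    unfolding d'_def tens_inner_left tens_inner_right using inner by auto
  note zero = inner.skew_universal_inv_zero[OF this]
  have "d' (nu R \<kappa> powi writhe D) = 0"
    by (rule skew_derivation_power_int_zero[OF inner.skew char assms zero(2)])
  with zero(1) have "d (universal_inv R \<kappa> D)
        - t * (\<chi> (universal_inv R \<kappa> D) - \<chi>' (universal_inv R \<kappa> D))
      = d (nu R \<kappa> powi writhe D) - t * (\<chi> (nu R \<kappa> powi writhe D) - \<chi>' (nu R \<kappa> powi writhe D))"
    by (simp add: d'_def)
  then show ?thesis
    by (simp add: character_universal_inv_nu char character_power_int assms)
next
  case uniform
  have "\<chi> (nu R \<kappa>) = \<chi>' (nu R \<kappa>)"
    using uniform by (simp add: character_nu char)
  then show ?thesis
    by (simp add: skew_universal_inv_uniform[OF uniform] skew_derivation_power_int[OF skew char assms])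
qed

end

section \<open>The Sweedler algebra\<close>

text \<open>For \<open>x = p(s) + q(s) w\<close> and \<open>a = \<plusminus>1\<close> these are \<open>p(a)\<close> and \<open>q(- a)\<close>.\<close>

definition sw_char :: "complex \<Rightarrow> SW \<Rightarrow> complex" where
  "sw_char a x = coeff x (Mono False False) + a * coeff x (Mono True False)"

definition sw_skew :: "complex \<Rightarrow> SW \<Rightarrow> complex" where
  "sw_skew a x = coeff x (Mono False True) - a * coeff x (Mono True True)"

lemma character_sw_char:
  assumes "a * a = 1"
  shows "character (sw_char a)"
proof -
  have "sw_char a (x * y) = sw_char a x * sw_char a y" for x y
  proof -
    \<comment> \<open>Sorting by powers of \<open>a\<close> isolates \<open>a * a\<close>, which is
      then replaced by \<open>1\<close>.\<close>
    have "sw_char a x * sw_char a y = coeff x (Mono False False) * coeff y (Mono False False)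
        + a * (coeff x (Mono False False) * coeff y (Mono True False)
            + coeff x (Mono True False) * coeff y (Mono False False))
        + (a * a) * (coeff x (Mono True False) * coeff y (Mono True False))"
      by (simp add: sw_char_def algebra_simps)
    then show ?thesis
      unfolding assms by (simp add: sw_char_def coeff_mult UNIV_sw struct_const_sw_def algebra_simps)
  qed
  then show ?thesis
    by (simp add: character_def clinear_def sw_char_def coeff_one unit_coeff_sw_def algebra_simps)
qed

lemma skew_derivation_sw_skew:
  assumes "a * a = 1"
  shows "skew_derivation (sw_char a) (sw_char (- a)) (sw_skew a)"
proof -
  have "sw_skew a (x * y) = sw_skew a x * sw_char a y + sw_char (- a) x * sw_skew a y" for x y
  proof -
    have "sw_skew a x * sw_char a y + sw_char (- a) x * sw_skew a y =
        coeff x (Mono False True) * coeff y (Mono False False)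
        + coeff x (Mono False False) * coeff y (Mono False True)
        + a * (coeff x (Mono False True) * coeff y (Mono True False)
          - coeff x (Mono True True) * coeff y (Mono False False)
          - coeff x (Mono True False) * coeff y (Mono False True)
          - coeff x (Mono False False) * coeff y (Mono True True))
        + (a * a) * (coeff x (Mono True False) * coeff y (Mono True True)
          - coeff x (Mono True True) * coeff y (Mono True False))"
      by (simp add: sw_char_def sw_skew_def algebra_simps)
    then show ?thesis
      unfolding assms
      by (simp add: sw_skew_def coeff_mult UNIV_sw struct_const_sw_def algebra_simps)
  qed
  then show ?thesis
    by (simp add: skew_derivation_def clinear_def sw_skew_def algebra_simps)
qed

text \<open>The values at \<open>a = 1\<close> and \<open>a = - 1\<close> are sum and difference of
  two coefficients and so determine both.\<close>

lemma sw_eqI: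
  assumes "\<And>a. a * a = 1 \<Longrightarrow> sw_char a x = sw_char a y" "\<And>a. a * a = 1 \<Longrightarrow> sw_skew a x = sw_skew a y"
  shows "x = y"
proof (rule alg_eqI)
  have half: "u = u' \<and> v = v'" if "u + v = u' + v'" "u - v = u' - v'" for u v u' v' :: complex
  proof -
    have "2 * u = 2 * u'"
      using arg_cong2[OF that, of "(+)"] by simp
    then show ?thesis
      using that(1) by simp
  qed
  fix i :: sw
  have "i \<in> {Mono False False, Mono True False, Mono False True, Mono True True}"
    by (simp flip: UNIV_sw)
  then show "coeff x i = coeff y i"
    using half[of "coeff x (Mono False False)" "coeff x (Mono True False)"
        "coeff y (Mono False False)" "coeff y (Mono True False)"]
      half[of "coeff x (Mono False True)" "coeff x (Mono True True)"
        "coeff y (Mono False True)" "coeff y (Mono True True)"]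
      assms(1)[of 1] assms(1)[of "- 1"] assms(2)[of 1] assms(2)[of "- 1"]
    by (auto simp: sw_char_def sw_skew_def)
qed

lemma sw_invertible:
  assumes "sw_char 1 x \<noteq> 0" "sw_char (- 1) x \<noteq> 0"
  shows "invertible x"
proof -
  define p where "p = sw_char 1 x"
  define m where "m = sw_char (- 1) x"
  \<comment> \<open>The part without \<open>w\<close> interpolates the inverse character values
    \<open>1 / p\<close> and \<open>1 / m\<close>; the part with \<open>w\<close> is forced by the
    formula for a skew derivation of an inverse.\<close>
  define y where "y = Alg (\<lambda>i. if w_exp i then - coeff x i / (p * m)
    else if s_exp i then (1 / p - 1 / m) / 2 else (1 / p + 1 / m) / 2)"
  have pm: "p \<noteq> 0" "m \<noteq> 0"
    using assms by (simp_all add: p_def m_def)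
  have cases: "a = 1 \<or> a = - 1" if "a * a = 1" for a :: complex
    using that by (simp add: square_eq_1_iff)
  have y: "sw_char 1 y = 1 / p" "sw_char (- 1) y = 1 / m"
    "sw_skew a y = - sw_skew a x / (p * m)" for a
    using pm by (simp_all add: sw_char_def sw_skew_def y_def field_simps)
  have one: "sw_skew a 1 = 0" for a
    by (simp add: sw_skew_def coeff_one unit_coeff_sw_def)
  have "x * y = 1"
  proof (rule sw_eqI)
    fix a :: complex
    assume a: "a * a = 1"
    note ch = character_sw_char[OF a]
    from cases[OF a] show "sw_char a (x * y) = sw_char a 1"
      unfolding character_mult[OF ch] character_one[OF ch] using pm
      by (auto simp: y simp flip: p_def m_def)
    from cases[OF a] show "sw_skew a (x * y) = sw_skew a 1"
      unfolding skew_derivation_mult[OF skew_derivation_sw_skew[OF a]] using pm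
      by (auto simp: y one simp flip: p_def m_def)
  qed
  moreover have "y * x = 1"
  proof (rule sw_eqI)
    fix a :: complex
    assume a: "a * a = 1"
    note ch = character_sw_char[OF a]
    from cases[OF a] show "sw_char a (y * x) = sw_char a 1"
      unfolding character_mult[OF ch] character_one[OF ch] using pm
      by (auto simp: y simp flip: p_def m_def)
    from cases[OF a] show "sw_skew a (y * x) = sw_skew a 1"
      unfolding skew_derivation_mult[OF skew_derivation_sw_skew[OF a]] using pm
      by (auto simp: y one simp flip: p_def m_def)
  qed
  ultimately show ?thesis
    unfolding invertible_def by blast
qed

text \<open>Both characters are non-zero on \<open>nu\<close>, being products of the non-zero values
  of \<open>\<kappa>\<close> and \<open>R\<close>.\<close>

lemma sw_invertible_nu:
  assumes "XC_structure R \<kappa>"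
  shows "invertible (nu R \<kappa> :: SW)"
proof -
  interpret XC R \<kappa>
    by unfold_locales (rule assms)
  have "sw_char a (nu R \<kappa>) \<noteq> 0" if "a * a = 1" for a
    using character_nu[OF character_sw_char[OF that]] character_kappa[OF character_sw_char[OF that]]
      tens_R_nonzero[OF character_sw_char[OF that] character_sw_char[OF that]] by auto
  then show ?thesis
    by (intro sw_invertible) simp_all
qed

theorem theorem1p1:
  fixes R :: "(sw \<times> sw) alg" and \<kappa> :: SW
  assumes "XC_structure R \<kappa>"
  shows "(\<forall>D. rotational_diagram D \<longrightarrow> universal_inv R \<kappa> D = nu R \<kappa> powi writhe D) \<and>
         (\<forall>D. rotational_diagram D \<and> writhe D = 0 \<longrightarrow> universal_inv R \<kappa> D = 1)"
proof -
  have "universal_inv R \<kappa> D = nu R \<kappa> powi writhe D" if "rotational_diagram D" for D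
  proof -
    interpret XC_knot R \<kappa> D
      using assms that by unfold_locales (simp_all add: rotational_diagram_def)
    note nu = sw_invertible_nu[OF assms]
    show ?thesis
    proof (rule sw_eqI)
      fix a :: complex
      assume a: "a * a = 1"
      note ch = character_sw_char[OF a] character_sw_char[of "- a", simplified, OF a]
      show "sw_char a (universal_inv R \<kappa> D) = sw_char a (nu R \<kappa> powi writhe D)"
        by (simp add: character_universal_inv_nu character_power_int ch nu)
      interpret XC_skew_knot R \<kappa> "sw_char a" "sw_char (- a)" "sw_skew a" D
        by unfold_locales (simp_all add: skew_derivation_sw_skew a ch)
      show "sw_skew a (universal_inv R \<kappa> D) = sw_skew a (nu R \<kappa> powi writhe D)"
        by (rule skew_universal_inv_nu[OF nu])
    qed
  qed
  then show ?thesis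
    by simp
qed

end
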